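(* Let $L$ be a connected, alternating (oriented) link diagram in $\mathbb{R}^{2}\setminus\{(0,0)\}$, checkerboard colored so that the $1$-resolutions merge the black regions, and let $\mathcal{L}$ be the corresponding link in $\mathbb{R}^{3}$, with signature $\sigma(\mathcal{L})$. For $k\in\mathbb{Z}$ let $g_{k}$ be the glyph determined by the unit circle labeled with $k$. Then $\underline{HT}_{\delta}(L,g_{k})$ is non-zero only if (1) $k$ is odd, and $\delta+k=\sigma(\mathcal{L})$; or (2) $k$ is even, the unbounded region is colored black, and $\delta+k=\sigma(\mathcal{L})-1$; or (3) $k$ is even, the unbounded region is colored white, and $\delta+k=\sigma(\mathcal{L})+1$.
   Context: Let $\Sigma=\mathbb{R}^2\setminus\{(0,0)\}$ with its standard orientation. $n_{+}(L)$ is the number of positive crossings of $L$. Each edge $f$ of $L$ gets a distinct formal variable $x_f$, and $\mathbb{F}_L$ is the field of rational functions over $\mathbb{Z}/2\mathbb{Z}$ in the $x_f$. For a subset $S$ of the crossings, the resolution $r_S$ is obtained by replacing each crossing $c\notin S$ by its $0$-resolution and each $c\in S$ by its $1$-resolution. The $0$-resolution joins the two local quadrants swept out when the over-strand is rotated counterclockwise until it meets the under-strand (for a positive crossing it is the orientation-respecting smoothing); the $1$-resolution is the other smoothing. $|r_S|=\#S$. A circle of a resolution is contractible if it bounds a disc in $\Sigma$, otherwise noncontractible. For a contractible circle $C$ put $[C]=\sum x_f$ over the edges $f$ on $C$. A checkerboard coloring colors the regions of $\Sigma\setminus L$ black and white so that regions sharing an edge have different colors; "the $1$-resolutions merge the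 black regions" means that at each crossing the $1$-resolution joins the two black quadrants. A glyph for $\Sigma$ is an equivalence class of disjointly embedded noncontractible circles labeled by integers, up to isotopy and erasure/introduction of $0$-labeled circles. For a state $r$ (a resolution without contractible circles, with a sign $\pm1$ on each circle), $\mathrm{gl}(r)$ is obtained by replacing each collection of circles that pairwise cobound annuli by one circle labeled by the sum of the signs; $k(r)$ is the sum of all signs of $r$. For a glyph $g$, $CT(L,g)$ is the $\mathbb{F}_L$-vector space spanned by the states $r$ with $\mathrm{gl}(r)=g$, with differential $\partial_n(r)=\sum_{r'}\langle r,r'\rangle r'$ over states with $|r'|=|r|+2$, $\mathrm{gl}(r')=g$. Here $\langle r,r'\rangle=0$ unless the resolution of $r'$ is obtained from that of $r$ by changing exactly two crossings $c_1,c_2$ from $0$ to $1$. In that case let $r_{10}$ (resp. $r_{01}$) be the resolution obtained from $r$ by changing only $c_1$ (resp. only $c_2$); then $\langle r,r'\rangle=a_{10}+a_{01}$, where $a_{10}=1/[C_{10}]$ if $r_{10}$ has a contractible circle $C_{10}$ and $r,r'$ are compatible through $r_{10}$, and $a_{10}=0$ otherwise; similarly for $a_{01}$. Compatible through $r_{10}$ means that the noncontractible circles of $r_{10}$ can be given signs such that: (i) in $r\to r_{10}$, either $C_{10}$ is split off from a noncontractible circle which keeps its sign, or $C_{10}$ is formed by merging two oppositely signed noncontractible circles; (ii) in $r_{10}\to r'$, either $C_{10}$ is merged into a noncontractible circle which keeps its sign, or $C_{10}$ is split into two noncontractible circles of opposite sign; (iii) all circles not involved keep their signs. The $\delta$-grading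 of a state (including the shift $[-n_+(L)]$) is $\delta(r)=|r|-k(r)-n_{+}(L)$, and $\underline{HT}_{\delta}(L,g)$ is the homology of $(CT(L,g),\partial_n)$ in $\delta$-grading $\delta$. Signature convention: the right-handed (positive) trefoil has signature $-2$; equivalently, for a connected alternating planar diagram colored so that $1$-resolutions merge black regions, $\sigma(\mathcal{L})=\#(\text{black regions})-1-n_+(L)$. *)

theory Defs
  imports
    "HOL-Analysis.Analysis"
    "HOL-Combinatorics.Orbits"
    "HOL-Computational_Algebra.Fraction_Field"
    "HOL-Library.Poly_Mapping"
    "HOL-Library.Z2"
begin

section \<open>Link diagrams in the punctured plane\<close>

text \<open>
  A connected oriented diagram is encoded as a planar map: the type \<open>'e\<close> is the set of its edges,
  every edge \<open>e\<close> is oriented from its end \<open>Tail e\<close> to its end \<open>Head e\<close>, and \<open>rot\<close> sends each edge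
  end to the next one counterclockwise around the vertex where it sits. The predicate \<open>over\<close> singles
  out the ends that lie on the over-strand. The plane is the sphere minus a point, so a diagram in
  the punctured plane has two distinguished regions (possibly equal), the one containing the origin
  and the unbounded one.
\<close>

datatype 'e edge_end = is_out: Tail (edge: 'e) | Head (edge: 'e)

primrec flip :: "'e edge_end \<Rightarrow> 'e edge_end" where
  "flip (Tail e) = Head e"
| "flip (Head e) = Tail e"

record 'e diagram =
  rot :: "'e edge_end \<Rightarrow> 'e edge_end"
  over :: "'e edge_end \<Rightarrow> bool"
  origin_region :: "'e edge_end set"
  unbounded_region :: "'e edge_end set"

definition vertex :: "'e diagram \<Rightarrow> 'e edge_end \<Rightarrow> 'e edge_end set" where
  "vertex L d = orbit (rot L) d"

definition crossings :: "'e diagram \<Rightarrow> 'e edge_end set set" where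
  "crossings L = {c \<in> range (vertex L). card c = 4}"

text \<open>
  A region is recorded by its corners. The corner named by \<open>d\<close> is the sector at the vertex of \<open>d\<close>
  between \<open>d\<close> and \<open>rot L d\<close>; it lies in the region to the left of \<open>d\<close> as seen when leaving the
  vertex along \<open>d\<close>.
\<close>

definition region :: "'e diagram \<Rightarrow> 'e edge_end \<Rightarrow> 'e edge_end set" where
  "region L d = orbit (\<lambda>d. flip (rot L d)) d"

definition regions :: "'e diagram \<Rightarrow> 'e edge_end set set" where
  "regions L = range (region L)"

text \<open>
  The second disjunct admits the diagram without crossings, an embedded circle. It is drawn
  with one auxiliary vertex where its single edge closes up; such a vertex is not a crossing, and by
  connectedness it cannot occur in a diagram that has crossings.
\<close>

definition connected_link_diagram :: "'e::finite diagram \<Rightarrow> bool" where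
  "connected_link_diagram L \<longleftrightarrow>
     bij (rot L) \<and>
     (\<forall>d. vertex L d \<in> crossings L \<and> (over L (rot L d) \<longleftrightarrow> \<not> over L d) \<and>
            (is_out (rot L (rot L d)) \<longleftrightarrow> \<not> is_out d)
        \<or> vertex L d = {d, flip d}) \<and>
     (\<forall>d d'. (d, d') \<in> ({(d, rot L d) | d. True} \<union> {(d, flip d) | d. True})\<^sup>*) \<and>
     int (card (range (vertex L))) - int CARD('e) + int (card (regions L)) = 2 \<and>
     origin_region L \<in> regions L \<and> unbounded_region L \<in> regions L"

definition alternating :: "'e diagram \<Rightarrow> bool" where
  "alternating L \<longleftrightarrow>
     (\<forall>e. vertex L (Tail e) \<in> crossings L \<longrightarrow> (over L (Head e) \<longleftrightarrow> \<not> over L (Tail e)))"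

text \<open>
  At a positive crossing the outgoing under-strand follows the outgoing over-strand
  counterclockwise; at a negative crossing it precedes it.
\<close>

definition positive_crossing :: "'e diagram \<Rightarrow> 'e edge_end set \<Rightarrow> bool" where
  "positive_crossing L c \<longleftrightarrow> (\<exists>d\<in>c. over L d \<and> is_out d \<and> is_out (rot L d))"

definition n_plus :: "'e diagram \<Rightarrow> nat" where
  "n_plus L = card {c \<in> crossings L. positive_crossing L c}"

definition checkerboard :: "'e diagram \<Rightarrow> 'e edge_end set set \<Rightarrow> bool" where
  "checkerboard L black \<longleftrightarrow>
     black \<subseteq> regions L \<and> (\<forall>d. region L d \<in> black \<longleftrightarrow> region L (flip d) \<notin> black)"

section \<open>Signature\<close>

definition positive_index :: "('a::euclidean_space \<Rightarrow> real) \<Rightarrow> 'a set \<Rightarrow> nat" where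
  "positive_index q V = Max {dim W | W. subspace W \<and> W \<subseteq> V \<and> (\<forall>x\<in>W. x \<noteq> 0 \<longrightarrow> q x > 0)}"

text \<open>
  The signature is that of the symmetrized Seifert form of the surface \<open>F\<close> given by Seifert's
  algorithm. \<open>F\<close> is spanned by the Seifert circles and one core arc for each half-twisted band;
  contracting the arcs recovers the underlying 4-valent graph, whose real 1-cycles are therefore
  mapped onto the first homology of \<open>F\<close>, with kernel spanned by the Seifert circles. As these bound
  discs in \<open>F\<close>, they lie in the radical of the symmetrized form, so the signature may be computed on
  cycles of the graph.

  At a crossing drawn with both strands going up, let \<open>d\<close> be the outgoing end on the left and
  \<open>rot L d\<close> the incoming end on the left. The flow of \<open>y\<close> through the band from left to right is
  \<open>y (rot L d) - y d\<close>. Hang the discs below the plane, so that near it \<open>F\<close> is vertical along the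
  Seifert circles and the positive push-off moves them to the left, whereas on the left half of a
  band the push-off lies above \<open>F\<close>. Then the band part of the push-off of \<open>y\<close> crosses
  over the left Seifert circle from left to right, past the branch point of \<open>x\<close> at a positive
  crossing (where \<open>x\<close> has coefficient \<open>x d\<close>) and before it at a negative one (coefficient
  \<open>x (rot L d)\<close>), and there are no other crossings of the push-off over \<open>x\<close>. Hence the linking
  number of \<open>x\<close> with the push-off of \<open>y\<close> is the sum below. At a positive crossing it is the
  under-strand that leaves on the left.
\<close>

definition cycle_space :: "'e::finite diagram \<Rightarrow> (real ^ 'e) set" where
  "cycle_space L = {x. \<forall>c\<in>range (vertex L).
     (\<Sum>d | d \<in> c \<and> is_out d. x $ edge d) = (\<Sum>d | d \<in> c \<and> \<not> is_out d. x $ edge d)}"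

definition seifert_form :: "'e::finite diagram \<Rightarrow> real ^ 'e \<Rightarrow> real ^ 'e \<Rightarrow> real" where
  "seifert_form L x y =
     (\<Sum>d | vertex L d \<in> crossings L \<and> is_out d \<and> \<not> is_out (rot L d).
        (if over L d then x $ edge (rot L d) else x $ edge d) * (y $ edge (rot L d) - y $ edge d))"

definition link_signature :: "'e::finite diagram \<Rightarrow> int" where
  "link_signature L =
     int (positive_index (\<lambda>x. 2 * seifert_form L x x) (cycle_space L)) -
     int (positive_index (\<lambda>x. - (2 * seifert_form L x x)) (cycle_space L))"

section \<open>Resolutions\<close>

text \<open>
  A resolution is the set \<open>S\<close> of crossings that receive the 1-resolution. Rotating the over-strand
  counterclockwise sweeps out the corners \<open>d\<close> with \<open>over L d\<close>; these are the quadrants joined by the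
  0-resolution, so its arcs cut off the corners \<open>d\<close> with \<open>\<not> over L d\<close>, i.e. connect such a \<open>d\<close> with
  \<open>rot L d\<close>. For the 1-resolution the roles are exchanged.
\<close>

definition joined_corner :: "'e diagram \<Rightarrow> 'e edge_end set set \<Rightarrow> 'e edge_end \<Rightarrow> bool" where
  "joined_corner L S d \<longleftrightarrow>
     vertex L d \<in> crossings L \<and> (if vertex L d \<in> S then \<not> over L d else over L d)"

definition one_resolutions_merge :: "'e diagram \<Rightarrow> 'e edge_end set set \<Rightarrow> bool" where
  "one_resolutions_merge L black \<longleftrightarrow>
     (\<forall>d. joined_corner L (crossings L) d \<longrightarrow> region L d \<in> black)"

definition arc_partner :: "'e diagram \<Rightarrow> 'e edge_end set set \<Rightarrow> 'e edge_end \<Rightarrow> 'e edge_end" where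
  "arc_partner L S d = (if joined_corner L S d then inv (rot L) d else rot L d)"

text \<open>A circle of a resolution is recorded as the set of edges on it.\<close>

definition circles :: "'e diagram \<Rightarrow> 'e edge_end set set \<Rightarrow> 'e set set" where
  "circles L S = range (\<lambda>d. edge ` orbit (\<lambda>d. arc_partner L S (flip d)) d)"

text \<open>
  Away from the circle \<open>C\<close> one can pass between the two quadrants joined at a crossing, and from one
  side to the other of an edge that is not on \<open>C\<close>. The equivalence classes of regions under these
  moves are the two components of the complement of \<open>C\<close> in the sphere, and \<open>C\<close> bounds a disc in
  the punctured plane iff one of them contains neither the origin nor infinity.
\<close>

definition same_side :: "'e diagram \<Rightarrow> 'e edge_end set set \<Rightarrow> 'e set \<Rightarrow> ('e edge_end set \<times> 'e edge_end set) set" where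
  "same_side L S C =
     ({(region L d, region L (rot L (rot L d))) | d. joined_corner L S d} \<union>
      {(region L d, region L (flip d)) | d. edge d \<notin> C})\<^sup>*"

definition contractible_circle :: "'e diagram \<Rightarrow> 'e edge_end set set \<Rightarrow> 'e set \<Rightarrow> bool" where
  "contractible_circle L S C \<longleftrightarrow> (origin_region L, unbounded_region L) \<in> same_side L S C"

section \<open>Glyphs and states\<close>

text \<open>
  Up to isotopy, disjoint noncontractible circles in the punctured plane labeled by integers are
  given by the list of labels from the innermost to the outermost circle. Erasing all circles with
  label 0 gives a normal form for the equivalence relation defining glyphs.
\<close>

definition glyph :: "int list \<Rightarrow> int list" where
  "glyph ls = filter (\<lambda>l. l \<noteq> 0) ls"

definition unit_circle_glyph :: "int \<Rightarrow> int list" where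
  "unit_circle_glyph k = glyph [k]"

text \<open>
  A state consists of a resolution and the set of those of its circles that carry the sign +1.
\<close>

type_synonym 'e state = "'e edge_end set set \<times> 'e set set"

definition states :: "'e diagram \<Rightarrow> 'e state set" where
  "states L = {(S, P). S \<subseteq> crossings L \<and> P \<subseteq> circles L S \<and>
     (\<forall>C\<in>circles L S. \<not> contractible_circle L S C)}"

definition sign :: "'e set set \<Rightarrow> 'e set \<Rightarrow> int" where
  "sign P C = (if C \<in> P then 1 else -1)"

definition sign_sum :: "'e diagram \<Rightarrow> 'e state \<Rightarrow> int" where
  "sign_sum L r = (\<Sum>C\<in>circles L (fst r). sign (snd r) C)"

text \<open>
  Any two disjoint noncontractible circles in the punctured plane cobound an annulus, so the
  circles of a state form a single collection of parallel circles. (If it were empty, the glyph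
  would be empty as well, in accordance with the formula.)
\<close>

definition gl :: "'e diagram \<Rightarrow> 'e state \<Rightarrow> int list" where
  "gl L r = glyph [sign_sum L r]"

definition delta :: "'e diagram \<Rightarrow> 'e state \<Rightarrow> int" where
  "delta L r = int (card (fst r)) - sign_sum L r - int (n_plus L)"

section \<open>The complex\<close>

text \<open>
  Rational functions over the field with two elements in the variables \<open>x f\<close>, where \<open>f\<close> ranges over
  the edges. The linear order on the edges is only needed for the library to recognize the polynomial
  ring as an integral domain.
\<close>

type_synonym 'e ratfun = "(('e \<Rightarrow>\<^sub>0 nat) \<Rightarrow>\<^sub>0 bit) fract"

definition edge_var :: "'e::linorder \<Rightarrow> 'e ratfun" where
  "edge_var f = Fract (Poly_Mapping.single (Poly_Mapping.single f 1) 1) 1"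

definition circle_weight :: "'e::linorder set \<Rightarrow> 'e ratfun" where
  "circle_weight C = (\<Sum>f\<in>C. edge_var f)"

text \<open>
  \<open>compatible_change L S P T C Q\<close>: the resolutions \<open>S\<close>, with signs given by \<open>P\<close>, and \<open>T\<close>, with
  contractible circle \<open>C\<close> and signs on its other circles given by \<open>Q\<close>, differ by splitting off \<open>C\<close>
  from a circle that keeps its sign, or by merging two oppositely signed circles into \<open>C\<close>; the circles
  common to both keep their signs. Read backwards, from \<open>T\<close> to \<open>S\<close>, it says that \<open>C\<close> is merged into a
  circle that keeps its sign or split into two circles of opposite sign.
\<close>

definition compatible_change ::
  "'e diagram \<Rightarrow> 'e edge_end set set \<Rightarrow> 'e set set \<Rightarrow> 'e edge_end set set \<Rightarrow> 'e set \<Rightarrow> 'e set set \<Rightarrow> bool" where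
  "compatible_change L S P T C Q \<longleftrightarrow>
     ((\<exists>D D'. circles L S - circles L T = {D} \<and> circles L T - circles L S = {C, D'} \<and> C \<noteq> D' \<and>
              sign P D = sign Q D') \<or>
      (\<exists>D D'. circles L S - circles L T = {D, D'} \<and> D \<noteq> D' \<and> circles L T - circles L S = {C} \<and>
              sign P D = - sign P D')) \<and>
     (\<forall>D \<in> circles L S \<inter> circles L T. sign P D = sign Q D)"

definition compatible_through ::
  "'e diagram \<Rightarrow> 'e edge_end set set \<Rightarrow> 'e set \<Rightarrow> 'e state \<Rightarrow> 'e state \<Rightarrow> bool" where
  "compatible_through L T C r r' \<longleftrightarrow>
     (\<exists>Q \<subseteq> circles L T - {C}.
        compatible_change L (fst r) (snd r) T C Q \<and> compatible_change L (fst r') (snd r') T C Q)"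

text \<open>
  The intermediate resolution \<open>T\<close> differs at one crossing from a resolution without contractible
  circles, hence has at most one contractible circle, and the sum has at most one term.
\<close>

definition through_coeff ::
  "'e::{finite,linorder} diagram \<Rightarrow> 'e edge_end set set \<Rightarrow> 'e state \<Rightarrow> 'e state \<Rightarrow> 'e ratfun" where
  "through_coeff L T r r' =
     (\<Sum>C | C \<in> circles L T \<and> contractible_circle L T C \<and> compatible_through L T C r r'.
        1 / circle_weight C)"

definition coeff_CT ::
  "'e::{finite,linorder} diagram \<Rightarrow> 'e state \<Rightarrow> 'e state \<Rightarrow> 'e ratfun" where
  "coeff_CT L r r' =
     (if fst r \<subseteq> fst r' \<and> card (fst r' - fst r) = 2
      then \<Sum>c\<in>fst r' - fst r. through_coeff L (insert c (fst r)) r r'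
      else 0)"

text \<open>Chains are functions on states; the basis element \<open>r\<close> is the indicator function of \<open>r\<close>.\<close>

definition CT_basis :: "'e diagram \<Rightarrow> int list \<Rightarrow> 'e state set" where
  "CT_basis L g = {r \<in> states L. gl L r = g}"

definition CT :: "'e::linorder diagram \<Rightarrow> int list \<Rightarrow> int \<Rightarrow> ('e state \<Rightarrow> 'e ratfun) set" where
  "CT L g d = {x. \<forall>r. x r \<noteq> 0 \<longrightarrow> r \<in> CT_basis L g \<and> delta L r = d}"

definition boundary_CT ::
  "'e::{finite,linorder} diagram \<Rightarrow> int list \<Rightarrow> ('e state \<Rightarrow> 'e ratfun) \<Rightarrow> 'e state \<Rightarrow> 'e ratfun" where
  "boundary_CT L g x r' =
     (if r' \<in> CT_basis L g then \<Sum>r\<in>CT_basis L g. x r * coeff_CT L r r' else 0)"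

text \<open>
  The differential raises the number of 1-resolutions by 2 and preserves the sum of the signs, so
  it raises the grading by 2.
\<close>

definition cycles_CT ::
  "'e::{finite,linorder} diagram \<Rightarrow> int list \<Rightarrow> int \<Rightarrow> ('e state \<Rightarrow> 'e ratfun) set" where
  "cycles_CT L g d = {x \<in> CT L g d. boundary_CT L g x = (\<lambda>_. 0)}"

definition boundaries_CT ::
  "'e::{finite,linorder} diagram \<Rightarrow> int list \<Rightarrow> int \<Rightarrow> ('e state \<Rightarrow> 'e ratfun) set" where
  "boundaries_CT L g d = boundary_CT L g ` CT L g (d - 2)"

text \<open>Homology as the set of cosets of the boundaries; its zero is \<open>boundaries_CT L g d\<close> itself.\<close>

definition HT ::
  "'e::{finite,linorder} diagram \<Rightarrow> int list \<Rightarrow> int \<Rightarrow> ('e state \<Rightarrow> 'e ratfun) set set" where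
  "HT L g d = (\<lambda>x. {(\<lambda>r. x r + b r) | b. b \<in> boundaries_CT L g d}) ` cycles_CT L g d"

definition HT_nonzero :: "'e::{finite,linorder} diagram \<Rightarrow> int list \<Rightarrow> int \<Rightarrow> bool" where
  "HT_nonzero L g d \<longleftrightarrow> HT L g d \<noteq> {boundaries_CT L g d}"

end

theory Submission
  imports Defs
begin

text \<open>
  The restriction on the gradings holds already for the generators of the complex. A state with sign
  sum \<open>k\<close> on the resolution \<open>S\<close> satisfies \<open>\<delta> + k = |S| - n_+\<close>, and its number of circles has the parity of
  \<open>k\<close>. So it has to be shown that \<open>|S|\<close> is determined by this parity and the color of the unbounded
  region. Let \<open>N\<close> be the number of black regions, and let \<open>B\<close> and \<open>W\<close> be the numbers of black and white
  components of the complement of the resolution. The proof consists of three formulas.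

  \<^item> \<open>B - W = N - 1 - |S|\<close> for every resolution (\<open>side_balance_eq\<close>). Switching one crossing lowers
    \<open>B - W\<close> by at most one: two black components may merge or a white component may split, but
    not both (\<open>side_balance_insert\<close>). By Euler's formula, switching all crossings lowers it by
    their number, so each switch lowers it by exactly one.

  \<^item> If all circles are noncontractible, each of them separates the origin from infinity, so the
    components form a path with alternating colors from the component of the origin to the
    unbounded one (\<open>bicolored_path_color_balance\<close>). Hence \<open>B - W = 0\<close> if the number of circles is odd,
    and otherwise \<open>B - W\<close> is \<open>1\<close> or \<open>-1\<close> according to the color of the unbounded region
    (\<open>side_balance_noncontractible\<close>).

  \<^item> The signature is \<open>N - 1 - n_+\<close> (\<open>link_signature_eq\<close>). Cycles of the diagram are written as
    boundaries of functions on the regions. Up to terms that cancel, the symmetrized Seifert form is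
    then the sum of a positive form in the values on black regions, a negative form in those on
    white regions, and mixed terms (\<open>seifert_form_edge_jump\<close>). The functions on which the two
    definite parts vanish are those that are constant on the components of the complement of the
    Seifert circles, and they lie in the radical of the whole form (\<open>seifert_functions_radical\<close>).
    So its indices are \<open>N\<close> and the number of white regions, reduced by the numbers of black
    and of white Seifert components; the first formula, applied to the Seifert resolution, evaluates
    their difference.

  Together these give \<open>\<delta> + k = \<sigma> - (B - W)\<close>.

  Everything is formulated in terms of functions on the edge ends, equivalently on the corners of the
  regions. Numbers of components are dimensions of spaces of locally constant functions.
\<close>

section \<open>Indices of quadratic forms and spaces of locally constant functions\<close>

lemma dim_le_dim_hyperplane_section:
  fixes S :: "'a::euclidean_space set"
  assumes "subspace S"
  shows "dim S \<le> dim (S \<inter> {x. a \<bullet> x = 0}) + 1"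
proof (cases "a = 0")
  case False
  have "dim {x + y | x y. x \<in> S \<and> y \<in> {x. a \<bullet> x = 0}} + dim (S \<inter> {x. a \<bullet> x = 0})
    = dim S + dim {x. a \<bullet> x = 0}"
    by (rule dim_sums_Int[OF assms subspace_hyperplane])
  moreover have "dim {x + y | x y. x \<in> S \<and> y \<in> {x. a \<bullet> x = 0}} \<le> DIM('a)"
    by (rule dim_subset_UNIV)
  moreover have "dim {x. a \<bullet> x = 0} = DIM('a) - 1"
    by (rule dim_hyperplane[OF False])
  moreover have "DIM('a) \<ge> 1"
    using DIM_positive by (simp add: Suc_le_eq)
  ultimately show ?thesis by linarith
qed auto

text \<open>
  A positive definite subspace meets \<open>N\<close> only in \<open>0\<close>, so its dimension is at most \<open>dim V - dim N\<close>, and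
  \<open>P\<close> attains this bound.
\<close>

lemma positive_index_eqI:
  fixes V :: "'a::euclidean_space set"
  assumes "subspace V"
    and P: "subspace P" "P \<subseteq> V" "\<And>x. x \<in> P \<Longrightarrow> x \<noteq> 0 \<Longrightarrow> q x > 0"
    and N: "subspace N" "N \<subseteq> V" "\<And>x. x \<in> N \<Longrightarrow> q x \<le> 0"
    and dim: "dim V \<le> dim P + dim N"
  shows "positive_index q V = dim P"
  unfolding positive_index_def
proof (rule Max_eqI)
  let ?D = "{dim W | W. subspace W \<and> W \<subseteq> V \<and> (\<forall>x\<in>W. x \<noteq> 0 \<longrightarrow> q x > 0)}"
  have "?D \<subseteq> {..DIM('a)}" using dim_subset_UNIV by auto
  then show "finite ?D" by (rule finite_subset) simp
  show "dim P \<in> ?D" using P by blast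
  fix m assume "m \<in> ?D"
  then obtain W where W: "m = dim W" "subspace W" "W \<subseteq> V" "\<forall>x\<in>W. x \<noteq> 0 \<longrightarrow> q x > 0"
    by auto
  have "W \<inter> N \<subseteq> {0}"
    using W(4) N(3) by force
  then have "dim (W \<inter> N) = 0" by (simp add: dim_eq_0)
  moreover have "dim {x + y | x y. x \<in> W \<and> y \<in> N} \<le> dim V"
    using W(3) N(2) subspace_add[OF \<open>subspace V\<close>] by (intro dim_subset) blast
  ultimately show "m \<le> dim P"
    using dim_sums_Int[OF W(2) N(1)] dim W(1) by linarith
qed

text \<open>
  The dimension of this space is the number of classes of the equivalence relation generated by \<open>R\<close>
  that lie in \<open>X\<close>. Components of a surface are counted in this way below, so that gluing two corners
  becomes intersecting with a hyperplane.
\<close>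

definition class_functions :: "('i \<times> 'i) set \<Rightarrow> 'i set \<Rightarrow> (real ^ 'i::finite) set" where
  "class_functions R X = {u. (\<forall>i. i \<notin> X \<longrightarrow> u $ i = 0) \<and> (\<forall>(i, j)\<in>R. u $ i = u $ j)}"

text \<open>
  The indicator functions of the classes are orthogonal and span the space.
\<close>

lemma dim_class_functions:
  fixes R :: "('i::finite \<times> 'i) set"
  assumes "sym R" and closed: "\<And>i j. (i, j) \<in> R \<Longrightarrow> i \<in> X \<Longrightarrow> j \<in> X"
  shows "dim (class_functions R X) = card ((\<lambda>i. R\<^sup>* `` {i}) ` X)"
proof -
  define cls where "cls i = R\<^sup>* `` {i}" for i
  define ind :: "'i set \<Rightarrow> real ^ 'i" where "ind C = (\<chi> i. if i \<in> C then 1 else 0)" for C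
  have R_sym: "sym (R\<^sup>*)" using \<open>sym R\<close> by (rule sym_rtrancl)
  have cls_eq: "cls i = cls j \<longleftrightarrow> (i, j) \<in> R\<^sup>*" for i j
    unfolding cls_def using symD[OF R_sym] by (auto intro: rtrancl_trans)
  have cls_disj: "cls i \<inter> cls j = {}" if "cls i \<noteq> cls j" for i j
  proof (rule equals0I)
    fix x assume "x \<in> cls i \<inter> cls j"
    then have "(i, x) \<in> R\<^sup>*" "(x, j) \<in> R\<^sup>*" using symD[OF R_sym] by (auto simp: cls_def)
    then show False using that cls_eq by (meson rtrancl_trans)
  qed
  have cls_self: "i \<in> cls i" for i unfolding cls_def by auto
  have ind_inj: "inj ind"
    unfolding ind_def by (rule injI) (auto simp: vec_eq_iff split: if_splits)
  have closed': "j \<in> X" if "(i, j) \<in> R\<^sup>*" "i \<in> X" for i j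
    using that by (induction) (auto intro: closed)
  have const: "u $ i = u $ j" if "u \<in> class_functions R X" "(i, j) \<in> R\<^sup>*" for u i j
    using that(2,1) by (induction) (auto simp: class_functions_def)
  let ?B = "ind ` cls ` X"
  have "pairwise orthogonal ?B"
  proof (clarsimp simp: pairwise_def)
    fix i j assume "ind (cls i) \<noteq> ind (cls j)"
    then have "cls i \<inter> cls j = {}" using cls_disj by metis
    then show "orthogonal (ind (cls i)) (ind (cls j))"
      unfolding orthogonal_def inner_vec_def ind_def by (auto intro!: sum.neutral)
  qed
  moreover have "0 \<notin> ?B"
  proof
    assume "0 \<in> ?B"
    then obtain i where "ind (cls i) $ i = 0" by (auto simp: image_iff) (metis zero_index)
    then show False using cls_self[of i] by (simp add: ind_def)
  qed
  ultimately have indep: "independent ?B"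
    by (rule pairwise_orthogonal_independent)
  have "ind (cls i) \<in> class_functions R X" if "i \<in> X" for i
  proof -
    have "(a \<in> cls i) = (b \<in> cls i)" if "(a, b) \<in> R" for a b
      using that symD[OF \<open>sym R\<close> that] unfolding cls_def by (auto intro: rtrancl_into_rtrancl)
    then show ?thesis
      using closed' that by (auto simp: class_functions_def ind_def cls_def)
  qed
  then have sub: "?B \<subseteq> class_functions R X" by auto
  have "u \<in> span ?B" if u: "u \<in> class_functions R X" for u
  proof -
    have val: "u $ (SOME j. j \<in> cls i) = u $ i" for i
    proof -
      have "(SOME j. j \<in> cls i) \<in> cls i" using cls_self by (rule someI)
      then show ?thesis using const[OF u] unfolding cls_def by auto
    qed
    have "u = (\<Sum>C\<in>cls ` X. u $ (SOME j. j \<in> C) *\<^sub>R ind C)"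
    proof (rule vec_eq_iff[THEN iffD2], rule allI)
      fix i
      show "u $ i = (\<Sum>C\<in>cls ` X. u $ (SOME j. j \<in> C) *\<^sub>R ind C) $ i"
      proof (cases "i \<in> X")
        case True
        have "(\<Sum>C\<in>cls ` X. u $ (SOME j. j \<in> C) *\<^sub>R ind C) $ i
          = (\<Sum>C\<in>cls ` X. if C = cls i then u $ i else 0)"
          unfolding sum_component
        proof (rule sum.cong[OF refl])
          fix C assume "C \<in> cls ` X"
          then obtain j where j: "C = cls j" by auto
          show "(u $ (SOME j. j \<in> C) *\<^sub>R ind C) $ i = (if C = cls i then u $ i else 0)"
            using j val[of i] cls_self[of i] cls_disj[of i j] by (auto simp: ind_def)
        qed
        then show ?thesis using True by simp
      next
        case False
        then have "ind C $ i = 0" if "C \<in> cls ` X" for C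
          using that closed' by (auto simp: ind_def cls_def)
        then have "(\<Sum>C\<in>cls ` X. u $ (SOME j. j \<in> C) *\<^sub>R ind C) $ i = 0"
          unfolding sum_component by (auto intro!: sum.neutral)
        then show ?thesis using False u by (auto simp: class_functions_def)
      qed
    qed
    also have "\<dots> \<in> span ?B"
      by (intro span_sum span_scale span_base imageI)
    finally show ?thesis .
  qed
  then have "dim (class_functions R X) = card ?B"
    using dim_unique[OF sub _ indep] by blast
  also have "\<dots> = card (cls ` X)"
    using ind_inj by (meson card_image inj_on_subset subset_UNIV)
  finally show ?thesis unfolding cls_def .
qed

lemma subspace_class_functions: "subspace (class_functions R X)"
  by (fastforce simp: subspace_def class_functions_def)

section \<open>Graphs in which every edge separates two given vertices\<close>

text \<open>
  The edges are labels with two end maps, because distinct circles of a resolution may a priori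
  separate the same two components.
\<close>

definition joined_by :: "('edge \<Rightarrow> 'v) \<Rightarrow> ('edge \<Rightarrow> 'v) \<Rightarrow> 'edge set \<Rightarrow> ('v \<times> 'v) set" where
  "joined_by a b E = {(a e, b e) | e. e \<in> E} \<union> {(b e, a e) | e. e \<in> E}"

lemma joined_by_mono: "E \<subseteq> F \<Longrightarrow> (joined_by a b E)\<^sup>* \<subseteq> (joined_by a b F)\<^sup>*"
  by (rule rtrancl_mono) (auto simp: joined_by_def)

text \<open>
  Such a graph is a path from \<open>v\<^sub>0\<close> to \<open>v\<^sub>1\<close>, along which the two colors alternate. The induction removes
  the end \<open>v\<^sub>1\<close>: it carries only one edge, since two edges at \<open>v\<^sub>1\<close> could not both separate it from
  \<open>v\<^sub>0\<close>, and the other end of this edge takes over the role of \<open>v\<^sub>1\<close>.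
\<close>

lemma bicolored_path_color_balance:
  fixes a b :: "'edge \<Rightarrow> 'v"
  assumes "finite V" "finite E" "v\<^sub>0 \<in> V" "v\<^sub>1 \<in> V"
    and "\<And>e. e \<in> E \<Longrightarrow> a e \<in> V \<and> b e \<in> V \<and> col (a e) \<and> \<not> col (b e)"
    and "\<And>v. v \<in> V \<Longrightarrow> (v\<^sub>0, v) \<in> (joined_by a b E)\<^sup>*"
    and "\<And>e. e \<in> E \<Longrightarrow> (v\<^sub>0, v\<^sub>1) \<notin> (joined_by a b (E - {e}))\<^sup>*"
  shows "int (card {v\<in>V. col v}) - int (card {v\<in>V. \<not> col v})
    = (if odd (card E) then 0 else if col v\<^sub>1 then 1 else -1)"
  using assms
proof (induction "card E" arbitrary: E V v\<^sub>1)
  case 0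
  then have "E = {}" by simp
  then have "joined_by a b E = {}" by (simp add: joined_by_def)
  then have "v = v\<^sub>0" if "v \<in> V" for v using "0.prems"(6)[OF that] by simp
  then have "V = {v\<^sub>1}" using "0.prems"(3,4) by auto
  then have "{v\<in>V. col v} = (if col v\<^sub>1 then {v\<^sub>1} else {})"
    "{v\<in>V. \<not> col v} = (if col v\<^sub>1 then {} else {v\<^sub>1})" by auto
  then show ?case using \<open>E = {}\<close> by simp
next
  case (Suc n)
  note ends = Suc.prems(5) and reach = Suc.prems(6) and sep = Suc.prems(7)
  from Suc.hyps(2) obtain e\<^sub>0 where "e\<^sub>0 \<in> E" by fastforce
  then have "v\<^sub>1 \<noteq> v\<^sub>0" using sep by blast
  then obtain u where "(u, v\<^sub>1) \<in> joined_by a b E"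
    using reach[OF Suc.prems(4)] by (metis rtranclE)
  then obtain e where e: "e \<in> E" "{a e, b e} = {u, v\<^sub>1}"
    unfolding joined_by_def by auto
  define K where "K = (joined_by a b (E - {e}))\<^sup>* `` {v\<^sub>0}"
  have "v\<^sub>1 \<notin> K" using sep[OF e(1)] by (simp add: K_def)
  have K_closed: "y \<in> K" if "x \<in> K" "(x, y) \<in> joined_by a b (E - {e})" for x y
    using that by (auto simp: K_def intro: rtrancl_into_rtrancl)
  have "u \<in> K"
  proof (rule ccontr)
    assume "u \<notin> K"
    have "x \<in> K" if "(v\<^sub>0, x) \<in> (joined_by a b E)\<^sup>*" for x
      using that
    proof induction
      case base
      then show ?case by (simp add: K_def)
    next
      case (step x y)
      have "(x, y) \<in> joined_by a b (E - {e})"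
        using step e(2) \<open>u \<notin> K\<close> \<open>v\<^sub>1 \<notin> K\<close> unfolding joined_by_def by (auto simp: doubleton_eq_iff)
      then show ?case using step K_closed by blast
    qed
    then show False using reach[OF Suc.prems(4)] \<open>v\<^sub>1 \<notin> K\<close> by blast
  qed
  \<comment> \<open>A second edge at \<open>v\<^sub>1\<close> would not separate, since its removal does not affect \<open>K\<close>.\<close>
  have only: "a e' \<noteq> v\<^sub>1 \<and> b e' \<noteq> v\<^sub>1" if e': "e' \<in> E - {e}" for e'
  proof (rule ccontr)
    assume *: "\<not> (a e' \<noteq> v\<^sub>1 \<and> b e' \<noteq> v\<^sub>1)"
    have "(v\<^sub>0, x) \<in> (joined_by a b (E - {e'}))\<^sup>*" if "(v\<^sub>0, x) \<in> (joined_by a b (E - {e}))\<^sup>*" for x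
      using that
    proof induction
      case base
      then show ?case by simp
    next
      case (step x y)
      have "x \<in> K" "y \<in> K" using step by (auto simp: K_def intro: rtrancl_into_rtrancl)
      then have "(x, y) \<in> joined_by a b (E - {e'})"
        using step(2) * \<open>v\<^sub>1 \<notin> K\<close> unfolding joined_by_def by auto
      then show ?case using step by (meson rtrancl_into_rtrancl)
    qed
    then have "(v\<^sub>0, u) \<in> (joined_by a b (E - {e'}))\<^sup>*" using \<open>u \<in> K\<close> by (simp add: K_def)
    moreover have "(u, v\<^sub>1) \<in> joined_by a b (E - {e'})"
      using e e' unfolding joined_by_def by (auto simp: doubleton_eq_iff)
    ultimately have "(v\<^sub>0, v\<^sub>1) \<in> (joined_by a b (E - {e'}))\<^sup>*" by (rule rtrancl_into_rtrancl)
    then show False using sep e' by blast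
  qed
  have u: "u \<in> V" "u \<noteq> v\<^sub>1" "col u \<longleftrightarrow> \<not> col v\<^sub>1"
    using ends[OF e(1)] e(2) by (auto simp: doubleton_eq_iff)
  have reach': "v = v\<^sub>1 \<or> (v\<^sub>0, v) \<in> (joined_by a b (E - {e}))\<^sup>*"
    if "(v\<^sub>0, v) \<in> (joined_by a b E)\<^sup>*" for v
    using that
  proof induction
    case (step x y)
    show ?case
    proof (cases "(x, y) \<in> joined_by a b (E - {e}) \<and> x \<noteq> v\<^sub>1")
      case True
      then show ?thesis using step by (meson rtrancl_into_rtrancl)
    next
      case False
      then have "y \<in> {u, v\<^sub>1}"
        using step(2) e(2) only unfolding joined_by_def by (auto simp: doubleton_eq_iff)
      then show ?thesis using \<open>u \<in> K\<close> by (auto simp: K_def)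
    qed
  qed simp
  have IH: "int (card {v\<in>V - {v\<^sub>1}. col v}) - int (card {v\<in>V - {v\<^sub>1}. \<not> col v})
    = (if odd (card (E - {e})) then 0 else if col u then 1 else -1)"
  proof (rule Suc.hyps(1))
    show "n = card (E - {e})" using Suc.hyps(2) e(1) Suc.prems(2) by simp
    show "(v\<^sub>0, v) \<in> (joined_by a b (E - {e}))\<^sup>*" if "v \<in> V - {v\<^sub>1}" for v
      using that reach' reach by blast
    show "(v\<^sub>0, u) \<notin> (joined_by a b (E - {e} - {e'}))\<^sup>*" if "e' \<in> E - {e}" for e'
    proof
      assume "(v\<^sub>0, u) \<in> (joined_by a b (E - {e} - {e'}))\<^sup>*"
      then have "(v\<^sub>0, u) \<in> (joined_by a b (E - {e'}))\<^sup>*"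
        using joined_by_mono[of "E - {e} - {e'}" "E - {e'}" a b] by auto
      moreover have "(u, v\<^sub>1) \<in> joined_by a b (E - {e'})"
        using e that unfolding joined_by_def by (auto simp: doubleton_eq_iff)
      ultimately have "(v\<^sub>0, v\<^sub>1) \<in> (joined_by a b (E - {e'}))\<^sup>*" by (rule rtrancl_into_rtrancl)
      then show False using sep that by blast
    qed
  qed (use Suc.prems u \<open>v\<^sub>1 \<noteq> v\<^sub>0\<close> only in auto)
  have "odd (card E) \<longleftrightarrow> even (card (E - {e}))"
    using Suc.prems(2) e(1) Suc.hyps(2) by (metis card_Suc_Diff1 even_Suc)
  moreover have "{v\<in>V. col v} = (if col v\<^sub>1 then insert v\<^sub>1 {v\<in>V - {v\<^sub>1}. col v} else {v\<in>V - {v\<^sub>1}. col v})"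
    "{v\<in>V. \<not> col v} = (if col v\<^sub>1 then {v\<in>V - {v\<^sub>1}. \<not> col v} else insert v\<^sub>1 {v\<in>V - {v\<^sub>1}. \<not> col v})"
    using Suc.prems(4) by auto
  moreover have "card (insert v\<^sub>1 {v\<in>V - {v\<^sub>1}. P v}) = card {v\<in>V - {v\<^sub>1}. P v} + 1" for P
    using Suc.prems(1) by simp
  ultimately show ?case using IH u(3) by (cases "col v\<^sub>1"; cases "odd (card E)") simp_all
qed

section \<open>Checkerboard colored diagrams\<close>

text \<open>
  Composing a permutation with the transposition of two points on different cycles merges the two
  cycles: from \<open>a\<close>, the map \<open>g\<close> enters the cycle of \<open>a'\<close> under \<open>f\<close> and follows it until it arrives at \<open>a'\<close>.
\<close>

lemma orbit_merge_by_transposition: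
  assumes "permutation f" "g a = f a'" "\<And>y. y \<in> orbit f a' \<Longrightarrow> y \<noteq> a' \<Longrightarrow> g y = f y"
  shows "a' \<in> orbit g a"
proof -
  have "a' \<in> orbit g a \<or> y \<in> orbit g a" if "y \<in> orbit f a'" for y
    using that
  proof induction
    case base
    then show ?case using assms(2) by (metis orbit.base)
  next
    case (step y)
    then show ?case using assms(3)[of y] by (metis orbit.step)
  qed
  then show ?thesis using permutation_self_in_orbit[OF assms(1), of a'] by blast
qed

text \<open>
  On a cycle of a permutation a step backwards is a sequence of steps forwards.
\<close>

lemma permutation_rtrancl_class:
  assumes "permutation f"
  shows "({(d, f d) | d. True} \<union> {(d, f d) | d. True}\<inverse>)\<^sup>* `` {d} = orbit f d"
proof -
  let ?R = "{(d, f d) | d. True} \<union> {(d, f d) | d. True}\<inverse>"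
  have self: "x \<in> orbit f x" for x using permutation_self_in_orbit[OF assms] .
  have "y \<in> orbit f d" if "(d, y) \<in> ?R\<^sup>*" for y
    using that
  proof induction
    case base
    then show ?case by (rule self)
  next
    case (step y z)
    then consider "z = f y" | "y = f z" by auto
    then show ?case
    proof cases
      case 1
      then show ?thesis using step.IH by (simp add: orbit.step)
    next
      case 2
      then have "z \<in> orbit f y" using permutation_orbit_step[OF assms, of z] self[of z] by simp
      then show ?thesis using step.IH by (rule orbit_trans)
    qed
  qed
  moreover have "(d, y) \<in> ?R\<^sup>*" if "y \<in> orbit f d" for y
    using that by induction (auto intro: rtrancl_into_rtrancl)
  ultimately show ?thesis by auto
qed

lemma permutation_orbit_eq:
  assumes "permutation f" "y \<in> orbit f x"
  shows "orbit f y = orbit f x"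
proof
  have "x \<in> orbit f y"
    by (rule orbit_swap[OF permutation_self_in_orbit[OF assms(1)] assms(2)])
  then show "orbit f x \<subseteq> orbit f y" using orbit_trans by fast
  show "orbit f y \<subseteq> orbit f x" using assms(2) orbit_trans by fast
qed

instance edge_end :: (finite) finite
proof
  have "(UNIV :: 'a edge_end set) = range Tail \<union> range Head"
    by (auto intro: edge_end.exhaust) (metis edge_end.exhaust rangeI)
  then show "finite (UNIV :: 'a edge_end set)" by (metis finite finite_Un finite_imageI)
qed

lemma flip_simps [simp]:
  "flip (flip d) = d" "edge (flip d) = edge d" "is_out (flip d) \<longleftrightarrow> \<not> is_out d" "flip d \<noteq> d"
  by (cases d; simp)+

lemma edge_eq_iff: "edge d = edge d' \<longleftrightarrow> d' = d \<or> d' = flip d"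
  by (cases d; cases d') auto

lemma sum_edge_ends: "(\<Sum>d\<in>UNIV. g d) = (\<Sum>e\<in>UNIV. g (Tail e) + g (Head e :: 'e::finite edge_end))"
proof -
  have U: "(UNIV :: 'e edge_end set) = range Tail \<union> range Head"
    by (auto intro: edge_end.exhaust) (metis edge_end.exhaust rangeI)
  have "(\<Sum>d\<in>UNIV. g d) = (\<Sum>d\<in>range Tail. g d) + (\<Sum>d\<in>range Head. g d)"
    unfolding U by (rule sum.union_disjoint) auto
  also have "\<dots> = (\<Sum>e\<in>UNIV. g (Tail e)) + (\<Sum>e\<in>UNIV. g (Head e))"
    by (subst (1 2) sum.reindex) (auto simp: inj_on_def)
  finally show ?thesis by (simp add: sum.distrib)
qed

text \<open>
  One step leads from a corner to the next one of the same region, or to the opposite corner if the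
  resolution joins the two. With the steps backwards added, reachability is an equivalence relation
  whose classes are the components of the complement of the resolution.
\<close>

definition side_steps :: "'e diagram \<Rightarrow> 'e edge_end set set \<Rightarrow> ('e edge_end \<times> 'e edge_end) set" where
  "side_steps L S =
     ({(d, flip (rot L d)) | d. True} \<union> {(d, rot L (rot L d)) | d. joined_corner L S d}) \<union>
     ({(d, flip (rot L d)) | d. True} \<union> {(d, rot L (rot L d)) | d. joined_corner L S d})\<inverse>"

lemma sym_side_steps: "sym (side_steps L S)"
  by (auto simp: side_steps_def intro: symI)

locale colored_diagram =
  fixes L :: "'e::finite diagram" and black :: "'e edge_end set set"
  assumes diagram: "connected_link_diagram L"
    and coloring: "checkerboard L black"
    and merging: "one_resolutions_merge L black"
begin

abbreviation at_crossing :: "'e edge_end \<Rightarrow> bool" where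
  "at_crossing d \<equiv> vertex L d \<in> crossings L"

abbreviation is_black :: "'e edge_end \<Rightarrow> bool" where
  "is_black d \<equiv> region L d \<in> black"

lemma bij_rot: "bij (rot L)"
  using diagram by (simp add: connected_link_diagram_def)

lemma permutation_rot: "permutation (rot L)"
  using bij_rot by (simp add: permutation)

lemma rot_inject [simp]: "rot L d = rot L d' \<longleftrightarrow> d = d'"
  using bij_is_inj[OF bij_rot] by (auto dest: injD)

lemma permutation_next_corner: "permutation (\<lambda>d. flip (rot L d))"
proof -
  have "bij (flip :: 'e edge_end \<Rightarrow> _)" by (rule involuntory_imp_bij) simp
  then have "bij (flip \<circ> rot L)" using bij_rot by (intro bij_comp)
  then show ?thesis by (simp add: permutation comp_def)
qed

lemma region_flip_rot [simp]: "region L (flip (rot L d)) = region L d"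
  unfolding region_def using permutation_orbit_step[OF permutation_next_corner] .

lemma vertex_rot [simp]: "vertex L (rot L d) = vertex L d"
  unfolding vertex_def using permutation_orbit_step[OF permutation_rot] .

lemma vertex_self: "d \<in> vertex L d"
  unfolding vertex_def by (rule permutation_self_in_orbit[OF permutation_rot])

lemma vertex_cases:
  "at_crossing d \<and> (over L (rot L d) \<longleftrightarrow> \<not> over L d) \<and> (is_out (rot L (rot L d)) \<longleftrightarrow> \<not> is_out d)
    \<or> \<not> at_crossing d \<and> rot L d = flip d"
proof -
  consider "at_crossing d" "over L (rot L d) \<longleftrightarrow> \<not> over L d" "is_out (rot L (rot L d)) \<longleftrightarrow> \<not> is_out d"
    | "vertex L d = {d, flip d}"
    using diagram unfolding connected_link_diagram_def by metis
  then show ?thesis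
  proof cases
    case 2
    have "card {d, flip d} \<noteq> 4" by (cases "d = flip d") auto
    then have "\<not> at_crossing d" using 2 by (simp add: crossings_def)
    moreover have "rot L d \<in> {d, flip d}"
      using 2 orbit.base[of "rot L" d] by (simp add: vertex_def)
    moreover have "rot L d \<noteq> d"
      using 2 orbit_eq_singleton_iff[of "rot L" d] flip_simps(4)[of d]
      by (metis insertI1 insert_commute singletonD vertex_def)
    ultimately show ?thesis by auto
  qed auto
qed

lemma rot_no_crossing: "\<not> at_crossing d \<Longrightarrow> rot L d = flip d"
  using vertex_cases by blast

lemma is_out_opposite: "at_crossing d \<Longrightarrow> is_out (rot L (rot L d)) \<longleftrightarrow> \<not> is_out d"
  using vertex_cases by blast

lemma rot_rot_no_crossing: "\<not> at_crossing d \<Longrightarrow> rot L (rot L d) = d"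
  by (metis flip_simps(1) rot_no_crossing vertex_rot)

lemma rot4 [simp]: "rot L (rot L (rot L (rot L d))) = d"
proof (cases "at_crossing d")
  case True
  let ?n = "funpow_dist1 (rot L) d d"
  have self: "d \<in> orbit (rot L) d" by (rule permutation_self_in_orbit[OF permutation_rot])
  have "card (orbit (rot L) d) = 4" using True by (simp add: crossings_def vertex_def)
  moreover have "card (orbit (rot L) d) = ?n"
    using orbit_conv_funpow_dist1[OF self] card_image[OF inj_on_funpow_dist1[OF self]] by simp
  ultimately have "((rot L) ^^ 4) d = d" using funpow_dist1_prop[OF self] by metis
  then show ?thesis by (simp add: numeral_eq_Suc)
qed (simp add: rot_rot_no_crossing)

lemma inv_rot: "inv (rot L) d = rot L (rot L (rot L d))"
  by (rule inv_f_eq) (use bij_rot bij_is_inj in auto)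

lemma vertex_eq: "vertex L d = {d, rot L d, rot L (rot L d), rot L (rot L (rot L d))}"
proof -
  have "vertex L d = {(rot L ^^ n) d | n. n < 4}"
    unfolding vertex_def by (rule orbit_altdef_bounded) (simp_all add: numeral_eq_Suc)
  also have "\<dots> = (\<lambda>n. (rot L ^^ n) d) ` {0, 1, 2, 3}"
  proof -
    have "{n. n < 4} = {0, 1, 2, 3 :: nat}" by auto
    then show ?thesis by (metis setcompr_eq_image)
  qed
  finally show ?thesis by (simp add: numeral_eq_Suc)
qed

lemma in_vertex: "x \<in> vertex L d \<Longrightarrow> vertex L d = vertex L x"
proof -
  assume "x \<in> vertex L d"
  then consider "x = d" | "x = rot L d" | "x = rot L (rot L d)" | "x = rot L (rot L (rot L d))"
    unfolding vertex_eq by blast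
  then show ?thesis by cases auto
qed

lemma color_flip [simp]: "is_black (flip d) \<longleftrightarrow> \<not> is_black d"
  using coloring unfolding checkerboard_def by blast

lemma color_rot [simp]: "is_black (rot L d) \<longleftrightarrow> \<not> is_black d"
  using color_flip[of "rot L d"] by simp

text \<open>
  Both the colors and the over- and under-strand alternate around a crossing, so it suffices that
  the corners of the under-strand, which the 1-resolution joins, are black.
\<close>

lemma over_iff_white: "at_crossing d \<Longrightarrow> over L d \<longleftrightarrow> \<not> is_black d"
proof -
  assume d: "at_crossing d"
  have *: "is_black d'" if "at_crossing d'" "\<not> over L d'" for d'
    using merging that by (auto simp: one_resolutions_merge_def joined_corner_def)
  show ?thesis using *[of d] *[of "rot L d"] d vertex_cases[of d] by auto
qed

lemma joined_corner_iff: "joined_corner L S d \<longleftrightarrow> at_crossing d \<and> (is_black d \<longleftrightarrow> vertex L d \<in> S)"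
  unfolding joined_corner_def using over_iff_white by auto

lemma arc_partner_eq:
  "arc_partner L S d = (if joined_corner L S d then rot L (rot L (rot L d)) else rot L d)"
  by (simp add: arc_partner_def inv_rot)

lemma edge_end_induct:
  assumes "P d\<^sub>0" "\<And>d. P d \<Longrightarrow> P (rot L d)" "\<And>d. P d \<Longrightarrow> P (flip d)"
  shows "P d"
proof -
  have "(d\<^sub>0, d) \<in> ({(d, rot L d) | d. True} \<union> {(d, flip d) | d. True})\<^sup>*"
    using diagram by (simp add: connected_link_diagram_def)
  then show ?thesis by induction (use assms in auto)
qed

text \<open>
  If there is a crossing, all vertices are crossings, of degree four; otherwise the diagram has a
  single edge and a single vertex.
\<close>

lemma card_vertices_plus_card_crossings:
  "card (range (vertex L)) + card (crossings L) = CARD('e)"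
proof (cases "\<forall>d. at_crossing d")
  case True
  then have eq: "range (vertex L) = crossings L" by (auto simp: crossings_def)
  have same: "c = c'" if cc: "c \<in> range (vertex L)" "c' \<in> range (vertex L)" "x \<in> c" "x \<in> c'" for c c' x
  proof -
    obtain a b where "c = vertex L a" "c' = vertex L b" using cc(1,2) by blast
    then show ?thesis using cc(3,4) in_vertex[of x a] in_vertex[of x b] by simp
  qed
  have "4 * card (range (vertex L)) = card (\<Union> (range (vertex L)))"
  proof (intro card_partition)
    show "card c = 4" if "c \<in> range (vertex L)" for c using that True by (auto simp: crossings_def)
    show "c \<inter> c' = {}" if "c \<in> range (vertex L)" "c' \<in> range (vertex L)" "c \<noteq> c'" for c c'
      using same[OF that(1,2)] that(3) by blast
  qed simp_all
  also have "\<Union> (range (vertex L)) = UNIV" using vertex_self by blast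
  also have "card (UNIV :: 'e edge_end set) = 2 * CARD('e)"
    using sum_edge_ends[of "\<lambda>d :: 'e edge_end. 1 :: nat"] by simp
  finally show ?thesis using eq by simp
next
  case False
  then obtain d where d: "\<not> at_crossing d" by blast
  have r: "rot L d = flip d" "rot L (flip d) = d"
    using rot_no_crossing[OF d] rot_rot_no_crossing[OF d] by auto
  have all: "x = d \<or> x = flip d" for x
    by (rule edge_end_induct[of "\<lambda>x. x = d \<or> x = flip d" d]) (use r in auto)
  then have "e = edge d" for e by (metis edge_end.sel(1) flip_simps(2))
  then have "(UNIV :: 'e set) = {edge d}" by auto
  then have E: "CARD('e) = 1" unfolding One_nat_def card_1_singleton_iff by blast
  have v: "vertex L x = vertex L d" for x
    using all[of x] rot_no_crossing[OF d] vertex_rot by metis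
  have "range (vertex L) = {vertex L d}" using v by auto
  moreover have "crossings L = {}"
  proof (rule equals0I)
    fix c assume c: "c \<in> crossings L"
    then have "c \<in> range (vertex L)" by (simp add: crossings_def)
    then have "c = vertex L d" using v by auto
    then show False using c d by simp
  qed
  ultimately show ?thesis using E by simp
qed

text \<open>
  This is Euler's formula for the sphere.
\<close>

lemma card_regions: "card (regions L) = card (crossings L) + 2"
  using diagram card_vertices_plus_card_crossings unfolding connected_link_diagram_def by linarith

section \<open>Sides of a resolution\<close>

text \<open>
  Locally constant functions on the complement of the resolution that vanish off the components of
  the given color.
\<close>

abbreviation side_functions :: "'e edge_end set set \<Rightarrow> bool \<Rightarrow> (real ^ 'e edge_end) set" where
  "side_functions S color \<equiv> class_functions (side_steps L S) {d. is_black d = color}"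

lemma side_functions_iff:
  "u \<in> side_functions S color \<longleftrightarrow>
     (\<forall>d. is_black d \<noteq> color \<longrightarrow> u $ d = 0) \<and> (\<forall>d. u $ flip (rot L d) = u $ d) \<and>
     (\<forall>d. joined_corner L S d \<longrightarrow> u $ rot L (rot L d) = u $ d)"
proof -
  have "(\<forall>(i, j)\<in>side_steps L S. u $ i = u $ j) \<longleftrightarrow> (\<forall>d. u $ flip (rot L d) = u $ d) \<and>
     (\<forall>d. joined_corner L S d \<longrightarrow> u $ rot L (rot L d) = u $ d)"
    unfolding side_steps_def by fastforce
  then show ?thesis by (simp add: class_functions_def)
qed

lemma dim_side_functions:
  "dim (side_functions S color) = card ((\<lambda>d. (side_steps L S)\<^sup>* `` {d}) ` {d. is_black d = color})"
  by (rule dim_class_functions[OF sym_side_steps]) (auto simp: side_steps_def)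

text \<open>
  The walk along the circles of the resolution: first along the arc at \<open>d\<close>, then along the edge that
  it reaches. Since the walk preserves the color of the corner, the black corners run through every
  circle in one of its two directions and through every edge of it once.
\<close>

definition trace_side :: "'e edge_end set set \<Rightarrow> 'e edge_end \<Rightarrow> 'e edge_end" where
  "trace_side S d = flip (arc_partner L S d)"

lemma arc_partner_involution: "arc_partner L S (arc_partner L S d) = d"
proof (cases "at_crossing d")
  case True
  then show ?thesis by (simp add: arc_partner_eq joined_corner_iff)
next
  case False
  then show ?thesis by (simp add: arc_partner_eq joined_corner_iff rot_rot_no_crossing)
qed

lemma permutation_trace_side: "permutation (trace_side S)"
proof -
  have "bij (flip :: 'e edge_end \<Rightarrow> _)" by (rule involuntory_imp_bij) simp
  moreover have "bij (arc_partner L S)" by (rule involuntory_imp_bij) (rule arc_partner_involution)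
  ultimately have "bij (flip \<circ> arc_partner L S)" using bij_comp by blast
  moreover have "trace_side S = flip \<circ> arc_partner L S" by (rule ext) (simp add: trace_side_def)
  ultimately show ?thesis by (simp add: permutation)
qed

lemma color_trace_side [simp]: "is_black (trace_side S d) \<longleftrightarrow> is_black d"
  by (simp add: trace_side_def arc_partner_eq)

lemma color_orbit_trace_side: "y \<in> orbit (trace_side S) d \<Longrightarrow> is_black y \<longleftrightarrow> is_black d"
  by (induction rule: orbit.induct) simp_all

lemma trace_side_steps: "(d, trace_side S d) \<in> (side_steps L S)\<^sup>*"
proof (cases "joined_corner L S d")
  case True
  then have "(d, rot L (rot L d)) \<in> side_steps L S" by (auto simp: side_steps_def)
  moreover have "(rot L (rot L d), trace_side S d) \<in> side_steps L S"
    using True by (auto simp: side_steps_def trace_side_def arc_partner_eq)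
  ultimately show ?thesis by (meson r_into_rtrancl rtrancl_into_rtrancl)
next
  case False
  then show ?thesis by (auto simp: side_steps_def trace_side_def arc_partner_eq intro!: r_into_rtrancl)
qed

lemma flip_trace_side_steps: "(flip d, flip (trace_side S d)) \<in> (side_steps L S)\<^sup>*"
proof -
  have prev: "(flip d, rot L (rot L (rot L d))) \<in> side_steps L S"
    unfolding side_steps_def by (auto intro!: exI[of _ "rot L (rot L (rot L d))"])
  show ?thesis
  proof (cases "joined_corner L S d \<or> \<not> at_crossing d")
    case True
    then have "flip (trace_side S d) = rot L (rot L (rot L d))"
      by (auto simp: trace_side_def arc_partner_eq rot_rot_no_crossing)
    then show ?thesis using prev by auto
  next
    case False
    then have "joined_corner L S (rot L d)" by (simp add: joined_corner_iff)
    then have "(rot L (rot L (rot L d)), flip (trace_side S d)) \<in> side_steps L S"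
      using False by (auto simp: side_steps_def trace_side_def arc_partner_eq)
    then show ?thesis using prev by (meson r_into_rtrancl rtrancl_into_rtrancl)
  qed
qed

text \<open>
  A circle has one component of the complement on either side: the corners named by the ends on the
  walk lie on one side of it, those named by the opposite ends of the same edges on the other.
\<close>

lemma orbit_trace_side_steps:
  assumes "y \<in> orbit (trace_side S) d"
  shows "(d, y) \<in> (side_steps L S)\<^sup>*" "(flip d, flip y) \<in> (side_steps L S)\<^sup>*"
  using assms
  by (induction) (auto intro: trace_side_steps flip_trace_side_steps rtrancl_trans)

lemma side_function_steps:
  assumes "u \<in> side_functions S color" "(d, d') \<in> (side_steps L S)\<^sup>*"
  shows "u $ d = u $ d'"
  using assms(2,1) by (induction) (auto simp: class_functions_def)

text \<open>
  Joining the opposite corners of one color at a crossing imposes one linear condition on the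
  functions of that color.
\<close>

lemma side_functions_change_crossing:
  assumes "\<And>d. vertex L d \<noteq> c \<Longrightarrow> joined_corner L S d = joined_corner L T d"
    and "vertex L w = c" "is_black w = color"
    and "u \<in> side_functions S color" "u $ w = u $ rot L (rot L w)"
  shows "u \<in> side_functions T color"
  unfolding side_functions_iff
proof (intro conjI allI impI)
  fix d assume d: "joined_corner L T d"
  show "u $ rot L (rot L d) = u $ d"
  proof (cases "vertex L d = c \<and> is_black d = color")
    case True
    then have "d \<in> vertex L w" using vertex_self[of d] assms(2) by simp
    then have "d = w \<or> d = rot L (rot L w)" using True assms(3) by (auto simp: vertex_eq)
    then show ?thesis using assms(5) by auto
  next
    case False
    then show ?thesis using assms(1,4) d unfolding side_functions_iff by (metis color_rot)
  qed
qed (use assms(4) in \<open>auto simp: side_functions_iff\<close>)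

lemma dim_side_functions_change_crossing:
  assumes "\<And>d. vertex L d \<noteq> c \<Longrightarrow> joined_corner L S d = joined_corner L T d"
    and "vertex L w = c" "is_black w = color"
  shows "dim (side_functions S color) \<le> dim (side_functions T color) + 1"
proof -
  let ?a = "axis w 1 - axis (rot L (rot L w)) (1 :: real)"
  have "side_functions S color \<inter> {u. ?a \<bullet> u = 0} \<subseteq> side_functions T color"
    using side_functions_change_crossing[OF assms]
    by (auto simp: inner_diff_left inner_axis')
  then have "dim (side_functions S color \<inter> {u. ?a \<bullet> u = 0}) \<le> dim (side_functions T color)"
    by (rule dim_subset)
  then show ?thesis
    using dim_le_dim_hyperplane_section[OF subspace_class_functions[of "side_steps L S" "{d. is_black d = color}"], of ?a]
    by linarith
qed

definition side_balance :: "'e edge_end set set \<Rightarrow> int" where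
  "side_balance S = int (dim (side_functions S True)) - int (dim (side_functions S False))"

text \<open>
  When the crossing \<open>c\<close> is switched, its two black corners become joined and its two white corners are
  cut apart. So the number of black components drops by at most one and that of the white ones grows
  by at most one. Both cannot happen: if the black corners lie on different circles before the
  change, these merge into one circle, which passes both white corners of \<open>c\<close> and so connects them
  along its other side; if they lie on the same circle, they are already in the same component.
\<close>

lemma side_balance_insert:
  assumes "c \<in> crossings L" "c \<notin> S"
  shows "side_balance S \<le> side_balance (insert c S) + 1"
proof -
  let ?T = "insert c S"
  obtain a\<^sub>0 where "c = vertex L a\<^sub>0" using assms(1) by (auto simp: crossings_def)
  then obtain a where a: "vertex L a = c" "is_black a"
    by (metis color_rot vertex_rot)
  define a' where "a' = rot L (rot L a)"
  have other: "joined_corner L S d = joined_corner L ?T d" if "vertex L d \<noteq> c" for d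
    using that by (simp add: joined_corner_iff)
  have B: "dim (side_functions S True) \<le> dim (side_functions ?T True) + 1"
    by (rule dim_side_functions_change_crossing[of c _ _ a]) (use a other in auto)
  have W: "dim (side_functions ?T False) \<le> dim (side_functions S False) + 1"
    by (rule dim_side_functions_change_crossing[of c _ _ "rot L a"]) (use a other in auto)
  show ?thesis
  proof (cases "a' \<in> orbit (trace_side S) a")
    case True
    have "side_functions S True \<subseteq> side_functions ?T True"
    proof
      fix u assume u: "u \<in> side_functions S True"
      then have "u $ a = u $ a'"
        using orbit_trace_side_steps(1)[OF True] by (rule side_function_steps)
      then show "u \<in> side_functions ?T True"
        by (intro side_functions_change_crossing[of c S ?T a]) (use u a other in \<open>auto simp: a'_def\<close>)
    qed
    then have "dim (side_functions S True) \<le> dim (side_functions ?T True)" by (rule dim_subset)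
    then show ?thesis using W by (simp add: side_balance_def)
  next
    case False
    have "a' \<in> orbit (trace_side ?T) a"
    proof (rule orbit_merge_by_transposition[OF permutation_trace_side[of S]])
      show "trace_side ?T a = trace_side S a'"
        using a assms by (simp add: trace_side_def arc_partner_eq joined_corner_iff a'_def)
      fix y assume y: "y \<in> orbit (trace_side S) a'" "y \<noteq> a'"
      have "y \<noteq> a"
        using y(1) False permutation_self_in_orbit[OF permutation_trace_side] orbit_swap by metis
      moreover have "is_black y" using color_orbit_trace_side[OF y(1)] a by (simp add: a'_def)
      ultimately have "vertex L y \<noteq> c"
        using y(2) a vertex_self[of y] by (auto simp: a'_def vertex_eq[of a])
      then show "trace_side ?T y = trace_side S y"
        using other by (simp add: trace_side_def arc_partner_eq)
    qed
    note steps = orbit_trace_side_steps(2)[OF this]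
    have "side_functions ?T False \<subseteq> side_functions S False"
    proof
      fix u assume u: "u \<in> side_functions ?T False"
      then have "u $ flip a = u $ flip a'" using steps by (rule side_function_steps)
      moreover have "u $ flip a = u $ rot L (rot L (rot L a))" "u $ flip a' = u $ rot L a"
        using u unfolding side_functions_iff a'_def by (metis rot4)+
      ultimately show "u \<in> side_functions S False"
        by (intro side_functions_change_crossing[of c ?T S "rot L a"]) (use u a other in auto)
    qed
    then have "dim (side_functions ?T False) \<le> dim (side_functions S False)" by (rule dim_subset)
    then show ?thesis using B by (simp add: side_balance_def)
  qed
qed

text \<open>
  If no corners of a color are joined, the components of that color are the regions.
\<close>

lemma dim_side_functions_regions:
  assumes "\<And>d. joined_corner L S d \<Longrightarrow> is_black d \<noteq> color"
  shows "dim (side_functions S color) = card {r \<in> regions L. (r \<in> black) = color}"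
proof -
  let ?R = "{(d, flip (rot L d)) | d. True} \<union> {(d, flip (rot L d)) | d. True}\<inverse>"
  have "u \<in> side_functions S color \<longleftrightarrow> u \<in> class_functions ?R {d. is_black d = color}" for u
  proof -
    have "u \<in> class_functions ?R {d. is_black d = color} \<longleftrightarrow>
      (\<forall>d. is_black d \<noteq> color \<longrightarrow> u $ d = 0) \<and> (\<forall>d. u $ flip (rot L d) = u $ d)"
      unfolding class_functions_def by fastforce
    then show ?thesis using assms unfolding side_functions_iff by auto
  qed
  then have "side_functions S color = class_functions ?R {d. is_black d = color}" by blast
  moreover have "dim (class_functions ?R {d. is_black d = color})
      = card ((\<lambda>d. ?R\<^sup>* `` {d}) ` {d. is_black d = color})"
    by (rule dim_class_functions) (auto intro: symI)
  moreover have "(\<lambda>d. ?R\<^sup>* `` {d}) ` {d. is_black d = color} = {r \<in> regions L. (r \<in> black) = color}"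
    unfolding permutation_rtrancl_class[OF permutation_next_corner] regions_def region_def by auto
  ultimately show ?thesis by simp
qed

text \<open>
  If all opposite corners of a color are joined, there is only one component of that color, because
  the diagram is connected.
\<close>

lemma dim_side_functions_all_joined:
  assumes "\<And>d. at_crossing d \<Longrightarrow> is_black d = color \<Longrightarrow> joined_corner L S d"
  shows "dim (side_functions S color) \<le> 1"
proof -
  define one :: "real ^ 'e edge_end" where "one = (\<chi> d. if is_black d = color then 1 else 0)"
  have "u \<in> span {one}" if u: "u \<in> side_functions S color" for u
  proof -
    have r: "u $ flip (rot L d) = u $ d" for d using u by (simp add: side_functions_iff)
    have opp: "u $ rot L (rot L d) = u $ d" for d
    proof (cases "at_crossing d \<and> is_black d = color")
      case True
      then show ?thesis using u assms by (simp add: side_functions_iff)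
    next
      case False
      then show ?thesis using u rot_rot_no_crossing[of d] unfolding side_functions_iff
        by (metis color_rot)
    qed
    \<comment> \<open>The value on the regions of the given color that meet at the vertex of \<open>d\<close>.\<close>
    define v where "v d = u $ (if is_black d = color then d else rot L d)" for d
    have "v (rot L d) = v d" for d using opp by (simp add: v_def)
    moreover have "v (flip d) = v d" for d
      using r[of "rot L (rot L (rot L d))"] opp[of "rot L d"] r[of "rot L (rot L (rot L (flip d)))"] opp[of "rot L (flip d)"]
      by (simp add: v_def)
    ultimately have v: "v d = v d'" for d d'
      using edge_end_induct[of "\<lambda>x. v x = v d'" d' d] by simp
    have "u = v undefined *\<^sub>R one"
    proof (rule vec_eq_iff[THEN iffD2], rule allI)
      fix d
      show "u $ d = (v undefined *\<^sub>R one) $ d"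
        using v[of undefined d] u by (auto simp: v_def one_def side_functions_iff)
    qed
    then show ?thesis by (metis span_base span_scale singletonI)
  qed
  then have "side_functions S color \<subseteq> span {one}" by blast
  then show ?thesis using dim_le_card[of "side_functions S color" "{one}"] by simp
qed

lemma card_black_white: "card {r \<in> regions L. r \<in> black} + card {r \<in> regions L. r \<notin> black} = card (crossings L) + 2"
proof -
  have "card {r \<in> regions L. r \<in> black} + card {r \<in> regions L. r \<notin> black} = card (regions L)"
    by (subst card_Un_disjoint[symmetric]) (auto intro: arg_cong[where f = card])
  then show ?thesis using card_regions by simp
qed

text \<open>
  Switching all crossings one after the other leads from the black regions and at most one white
  component to at most one black component and the white regions. By Euler's formula the balance drops
  by at least the number of crossings on the way, so by the preceding estimate for a single crossing
  every step lowers it by exactly one.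
\<close>

lemma side_balance_eq:
  assumes "S \<subseteq> crossings L"
  shows "side_balance S = int (card {r \<in> regions L. r \<in> black}) - 1 - int (card S)"
proof -
  have chain: "side_balance S \<le> side_balance T + int (card (T - S))"
    if "S \<subseteq> T" "T \<subseteq> crossings L" for S T
  proof -
    have "side_balance S \<le> side_balance (S \<union> F) + int (card F)" if "finite F" "F \<subseteq> crossings L - S" for F
      using that
    proof (induction F rule: finite_induct)
      case (insert c F)
      have "side_balance (S \<union> F) \<le> side_balance (insert c (S \<union> F)) + 1"
        using insert by (intro side_balance_insert) auto
      then show ?case using insert by auto
    qed simp
    from this[of "T - S"] show ?thesis using that by (simp add: Un_absorb1 Diff_mono)
  qed
  let ?N = "card {r \<in> regions L. r \<in> black}" and ?W = "card {r \<in> regions L. r \<notin> black}"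
  have "dim (side_functions {} True) = ?N" "dim (side_functions (crossings L) False) = ?W"
    using dim_side_functions_regions[of "{}" True] dim_side_functions_regions[of "crossings L" False]
    by (auto simp: joined_corner_iff)
  moreover have "dim (side_functions {} False) \<le> 1" "dim (side_functions (crossings L) True) \<le> 1"
    by (rule dim_side_functions_all_joined; simp add: joined_corner_iff)+
  ultimately have "side_balance {} \<ge> int ?N - 1" "side_balance (crossings L) \<le> 1 - int ?W"
    by (auto simp: side_balance_def)
  moreover have "side_balance {} \<le> side_balance S + int (card S)"
    using chain[of "{}" S] assms by simp
  moreover have "side_balance S \<le> side_balance (crossings L) + int (card (crossings L - S))"
    using chain assms by simp
  moreover have "card (crossings L - S) + card S = card (crossings L)"
    using assms by (simp add: card_Diff_subset card_mono finite_subset)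
  ultimately show ?thesis using card_black_white by linarith
qed

section \<open>The Seifert form on region functions\<close>

definition region_functions :: "(real ^ 'e edge_end) set" where
  "region_functions = {u. \<forall>d. u $ flip (rot L d) = u $ d}"

text \<open>
  If \<open>u\<close> is a function on the regions, this is the cycle that bounds it: the coefficient of an edge is
  the value of \<open>u\<close> on its left minus the value on its right. If \<open>u\<close> is a function on the vertices, it is
  the coboundary of \<open>u\<close>.
\<close>

definition edge_jump :: "real ^ 'e edge_end \<Rightarrow> real ^ 'e" where
  "edge_jump u = (\<chi> e. u $ Tail e - u $ Head e)"

lemma linear_edge_jump: "linear edge_jump"
  by (rule linearI) (simp_all add: edge_jump_def vec_eq_iff algebra_simps)

lemma edge_jump_edge:
  "edge_jump u $ edge d = (if is_out d then u $ d - u $ flip d else u $ flip d - u $ d)"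
  by (cases d) (simp_all add: edge_jump_def)

lemma subspace_region_functions: "subspace region_functions"
  by (simp add: subspace_def region_functions_def)

lemma sum_rot: "(\<Sum>d\<in>UNIV. g (rot L d)) = (\<Sum>d\<in>UNIV. g d)"
  by (rule sum.reindex_bij_betw) (rule bij_rot)

lemma sum_flip_rot: "(\<Sum>d\<in>UNIV. g (flip (rot L d))) = (\<Sum>d\<in>UNIV. g d)"
  by (rule sum.reindex_bij_betw) (rule permutation_bijective[OF permutation_next_corner])

lemma edge_jump_in_cycle_space:
  assumes u: "u \<in> region_functions"
  shows "edge_jump u \<in> cycle_space L"
  unfolding cycle_space_def
proof (intro CollectI ballI)
  fix c assume "c \<in> range (vertex L)"
  then obtain d\<^sub>0 where c: "c = vertex L d\<^sub>0" by blast
  have "bij_betw (rot L) c c"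
  proof (rule bij_betw_imageI)
    show "inj_on (rot L) c" by (rule inj_onI) simp
    show "rot L ` c = c" unfolding c vertex_eq by auto
  qed
  then have "(\<Sum>d\<in>c. u $ flip (rot L d)) = (\<Sum>d\<in>c. u $ flip d)"
    by (rule sum.reindex_bij_betw)
  then have "(\<Sum>d\<in>c. u $ d - u $ flip d) = 0"
    using u by (simp add: sum_subtractf region_functions_def)
  moreover have "(\<Sum>d\<in>c. u $ d - u $ flip d)
    = (\<Sum>d | d \<in> c \<and> is_out d. u $ d - u $ flip d) + (\<Sum>d | d \<in> c \<and> \<not> is_out d. u $ d - u $ flip d)"
    by (subst sum.union_disjoint[symmetric]) (auto intro!: sum.cong)
  moreover have "(\<Sum>d | d \<in> c \<and> is_out d. edge_jump u $ edge d) = (\<Sum>d | d \<in> c \<and> is_out d. u $ d - u $ flip d)"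
    by (rule sum.cong) (auto simp: edge_jump_edge)
  moreover have "(\<Sum>d | d \<in> c \<and> \<not> is_out d. edge_jump u $ edge d)
      = - (\<Sum>d | d \<in> c \<and> \<not> is_out d. u $ d - u $ flip d)"
    unfolding sum_negf[symmetric] by (rule sum.cong) (auto simp: edge_jump_edge)
  ultimately show "(\<Sum>d | d \<in> c \<and> is_out d. edge_jump u $ edge d)
      = (\<Sum>d | d \<in> c \<and> \<not> is_out d. edge_jump u $ edge d)"
    by linarith
qed

text \<open>
  A function without jumps is invariant under \<open>flip\<close>, by hypothesis also under \<open>rot L\<close>, hence constant as
  the diagram is connected; and the constant functions meet the hyperplane of functions with
  vanishing sum only in \<open>0\<close>.
\<close>

lemma dim_edge_jump_image:
  assumes "subspace S"
    and const: "\<And>u d. u \<in> S \<Longrightarrow> (\<And>d. u $ flip d = u $ d) \<Longrightarrow> u $ rot L d = u $ d"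
  shows "dim S \<le> dim (edge_jump ` S) + 1"
proof -
  let ?one = "1 :: real ^ 'e edge_end"
  let ?S = "S \<inter> {u. ?one \<bullet> u = 0}"
  have "subspace ?S" by (intro subspace_inter assms(1) subspace_hyperplane)
  have "inj_on edge_jump ?S"
  proof (rule inj_onI)
    fix x y assume xy: "x \<in> ?S" "y \<in> ?S" "edge_jump x = edge_jump y"
    define u where "u = x - y"
    have u: "u \<in> S" "?one \<bullet> u = 0"
      using xy subspace_diff[OF assms(1)] by (auto simp: u_def inner_diff_right)
    have "edge_jump u = 0" using xy(3) linear_diff[OF linear_edge_jump] by (simp add: u_def)
    then have tail_head: "u $ Tail e = u $ Head e" for e by (simp add: edge_jump_def vec_eq_iff)
    have fl: "u $ flip d = u $ d" for d by (cases d) (simp_all add: tail_head)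
    have rt: "u $ rot L d = u $ d" for d using const[OF u(1) fl] .
    have c: "u $ d = u $ undefined" for d
      by (rule edge_end_induct[of "\<lambda>d. u $ d = u $ undefined" undefined]) (simp_all add: fl rt)
    have "?one \<bullet> u = (\<Sum>d\<in>UNIV. u $ d)" by (simp add: inner_vec_def)
    also have "\<dots> = (\<Sum>d\<in>(UNIV :: 'e edge_end set). u $ undefined)" using c by (rule sum.cong[OF refl])
    also have "\<dots> = of_nat (card (UNIV :: 'e edge_end set)) * u $ undefined" by simp
    finally have "u $ undefined = 0" using u(2) by simp
    then have "u = 0" using c by (simp add: vec_eq_iff)
    then show "x = y" by (simp add: u_def)
  qed
  then have "dim (edge_jump ` ?S) = dim ?S"
    using dim_image_eq[OF linear_edge_jump] span_eq_iff[of ?S] \<open>subspace ?S\<close> by metis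
  moreover have "dim (edge_jump ` ?S) \<le> dim (edge_jump ` S)" by (intro dim_subset image_mono) auto
  moreover have "dim S \<le> dim ?S + 1" by (rule dim_le_dim_hyperplane_section[OF assms(1)])
  ultimately show ?thesis by linarith
qed

lemma subspace_cycle_space: "subspace (cycle_space L)"
  by (simp add: subspace_def cycle_space_def sum.distrib sum_distrib_left[symmetric])

text \<open>
  Cycles are orthogonal to coboundaries: sorted by vertices, the sum collects at each vertex the
  difference of the outflow and the inflow.
\<close>

lemma cycle_orthogonal_edge_jump:
  assumes x: "x \<in> cycle_space L" and y: "\<And>d. y $ rot L d = y $ d"
  shows "x \<bullet> edge_jump y = 0"
proof -
  define g where "g d = (if is_out d then x $ edge d else - x $ edge d) * y $ d" for d
  have "x \<bullet> edge_jump y = (\<Sum>e\<in>UNIV. g (Tail e) + g (Head e))"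
    unfolding inner_vec_def by (rule sum.cong) (simp_all add: edge_jump_def g_def algebra_simps)
  also have "\<dots> = (\<Sum>d\<in>UNIV. g d)" by (rule sum_edge_ends[symmetric])
  also have "\<dots> = (\<Sum>c\<in>range (vertex L). \<Sum>d | d \<in> UNIV \<and> vertex L d = c. g d)"
    by (rule sum.image_gen) simp
  also have "\<dots> = 0"
  proof (rule sum.neutral, rule ballI)
    fix c assume c: "c \<in> range (vertex L)"
    then obtain d\<^sub>0 where d\<^sub>0: "c = vertex L d\<^sub>0" by blast
    have mem: "d \<in> UNIV \<and> vertex L d = c \<longleftrightarrow> d \<in> c" for d
      using in_vertex[of d d\<^sub>0] vertex_self[of d] d\<^sub>0 by auto
    have yc: "y $ d = y $ d\<^sub>0" if "d \<in> c" for d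
      using that y unfolding d\<^sub>0 vertex_eq by auto
    have "(\<Sum>d | d \<in> UNIV \<and> vertex L d = c. g d) = (\<Sum>d\<in>c. g d)" unfolding mem by simp
    also have "\<dots> = (\<Sum>d | d \<in> c \<and> is_out d. g d) + (\<Sum>d | d \<in> c \<and> \<not> is_out d. g d)"
      by (subst sum.union_disjoint[symmetric]) (auto intro!: sum.cong)
    also have "(\<Sum>d | d \<in> c \<and> is_out d. g d) = (\<Sum>d | d \<in> c \<and> is_out d. x $ edge d) * y $ d\<^sub>0"
      unfolding sum_distrib_right by (rule sum.cong) (auto simp: g_def yc)
    also have "(\<Sum>d | d \<in> c \<and> \<not> is_out d. g d) = - (\<Sum>d | d \<in> c \<and> \<not> is_out d. x $ edge d) * y $ d\<^sub>0"
      unfolding sum_distrib_right sum_negf[symmetric] by (rule sum.cong) (auto simp: g_def yc)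
    also have "(\<Sum>d | d \<in> c \<and> is_out d. x $ edge d) = (\<Sum>d | d \<in> c \<and> \<not> is_out d. x $ edge d)"
      using x c unfolding cycle_space_def by blast
    finally show "(\<Sum>d | d \<in> UNIV \<and> vertex L d = c. g d) = 0" by simp
  qed
  finally show ?thesis .
qed

text \<open>
  By the orthogonality to the coboundaries, whose space has dimension at least the number of
  vertices minus one.
\<close>

lemma dim_cycle_space: "dim (cycle_space L) \<le> card (crossings L) + 1"
proof -
  let ?R = "{(d, rot L d) | d. True} \<union> {(d, rot L d) | d. True}\<inverse>"
  define V where "V = class_functions ?R UNIV"
  have V_rot: "u $ rot L d = u $ d" if "u \<in> V" for u d
    using that unfolding V_def class_functions_def by fastforce
  have "subspace V" unfolding V_def by (rule subspace_class_functions)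
  have "dim V = card (range (vertex L))"
  proof -
    have "dim V = card (range (\<lambda>d. ?R\<^sup>* `` {d}))"
      unfolding V_def by (rule dim_class_functions) (auto intro: symI)
    then show ?thesis unfolding permutation_rtrancl_class[OF permutation_rot] vertex_def .
  qed
  moreover have "dim V \<le> dim (edge_jump ` V) + 1"
    using \<open>subspace V\<close> by (rule dim_edge_jump_image) (rule V_rot)
  moreover have "dim {x \<in> UNIV. \<forall>t\<in>edge_jump ` V. orthogonal t x} + dim (edge_jump ` V) = dim (UNIV :: (real ^ 'e) set)"
    by (intro dim_subspace_orthogonal_to_vectors linear_subspace_image[OF linear_edge_jump] \<open>subspace V\<close>)
      auto
  moreover have "dim (cycle_space L) \<le> dim {x \<in> UNIV. \<forall>t\<in>edge_jump ` V. orthogonal t x}"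
    using cycle_orthogonal_edge_jump V_rot
    by (intro dim_subset) (auto simp: orthogonal_def inner_commute)
  moreover have "dim (UNIV :: (real ^ 'e) set) = CARD('e)" by simp
  ultimately show ?thesis using card_vertices_plus_card_crossings by linarith
qed

text \<open>
  At a crossing drawn with both strands going up, this is the end at the left corner; it is followed
  counterclockwise by the ends at the bottom, right and top corners.
\<close>

definition left_corners :: "'e edge_end set" where
  "left_corners = {d. at_crossing d \<and> is_out d \<and> \<not> is_out (rot L d)}"

text \<open>
  The value at the top corner minus the value at the bottom corner.
\<close>

definition drop_across :: "real ^ 'e edge_end \<Rightarrow> 'e edge_end \<Rightarrow> real" where
  "drop_across u d = u $ rot L (rot L (rot L d)) - u $ rot L d"

text \<open>
  The top corners of the crossings are the corners from which both adjacent edges leave, and the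
  bottom corners are those at which both adjacent edges arrive.
\<close>

lemma sum_left_corners:
  fixes f g :: "'e edge_end \<Rightarrow> real"
  shows "(\<Sum>d\<in>left_corners. f (rot L (rot L (rot L d))) - g (rot L d))
    = (\<Sum>d\<in>UNIV. (if is_out d \<and> is_out (rot L d) then f d else 0)
        - (if \<not> is_out d \<and> \<not> is_out (rot L d) then g d else 0))"
proof -
  have left: "d \<in> left_corners \<longleftrightarrow> is_out (rot L (rot L (rot L d))) \<and> is_out d"
    "d \<in> left_corners \<longleftrightarrow> \<not> is_out (rot L d) \<and> \<not> is_out (rot L (rot L d))" for d
    using is_out_opposite[of d] is_out_opposite[of "rot L d"] rot_no_crossing[of d] rot_rot_no_crossing[of d]
    by (cases "at_crossing d"; auto simp: left_corners_def)+
  define F where "F d = (if is_out d \<and> is_out (rot L d) then f d else 0)" for d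
  define G where "G d = (if \<not> is_out d \<and> \<not> is_out (rot L d) then g d else 0)" for d
  have "(\<Sum>d\<in>left_corners. f (rot L (rot L (rot L d))) - g (rot L d))
      = (\<Sum>d\<in>UNIV. if d \<in> left_corners then f (rot L (rot L (rot L d))) - g (rot L d) else 0)"
    by (simp add: sum.If_cases)
  also have "\<dots> = (\<Sum>d\<in>UNIV. F (rot L (rot L (rot L d))) - G (rot L d))"
    by (rule sum.cong) (use left in \<open>auto simp: F_def G_def\<close>)
  also have "\<dots> = (\<Sum>d\<in>UNIV. F d - G d)"
    unfolding sum_subtractf
    using sum_rot[of G] sum_rot[of F] sum_rot[of "\<lambda>d. F (rot L d)"] sum_rot[of "\<lambda>d. F (rot L (rot L d))"]
    by simp
  finally show ?thesis by (simp add: F_def G_def)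
qed

text \<open>
  Along the boundary of a region, top and bottom corners of crossings alternate up to corners of
  other kinds, so a function on the regions contributes as often with either sign.
\<close>

lemma sum_squares_left_corners:
  assumes u: "u \<in> region_functions"
  shows "(\<Sum>d\<in>left_corners. (u $ rot L (rot L (rot L d)))\<^sup>2 - (u $ rot L d)\<^sup>2) = 0"
proof -
  \<comment> \<open>Passing to the next corner, \<open>h\<close> drops at a top corner and rises at a bottom corner, by the
  square of the same value of \<open>u\<close>.\<close>
  define h :: "'e edge_end \<Rightarrow> real" where "h d = (if is_out d then (u $ d)\<^sup>2 else 0)" for d
  have "(\<Sum>d\<in>left_corners. (u $ rot L (rot L (rot L d)))\<^sup>2 - (u $ rot L d)\<^sup>2)
    = (\<Sum>d\<in>UNIV. h d - h (flip (rot L d)))"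
    unfolding sum_left_corners[of "\<lambda>d. (u $ d)\<^sup>2" "\<lambda>d. (u $ d)\<^sup>2"]
    by (rule sum.cong) (use u in \<open>auto simp: h_def region_functions_def\<close>)
  also have "\<dots> = 0" unfolding sum_subtractf sum_flip_rot by simp
  finally show ?thesis .
qed

text \<open>
  With the values \<open>l\<close>, \<open>t\<close>, \<open>b\<close> of \<open>u\<close> at the left, top and bottom corner, a crossing contributes to
  twice the form \<open>2 * (l - t) * (t - b)\<close> if the left corner is black (positive crossing) and
  \<open>2 * (l - b) * (t - b)\<close> if it is white (negative crossing). This is \<open>2 * l * (t - b)\<close> minus or plus \<open>(t - b)\<^sup>2\<close>, up to
  \<open>t\<^sup>2 - b\<^sup>2\<close>, which cancels in the sum over all crossings.
\<close>

lemma seifert_form_edge_jump: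
  assumes u: "u \<in> region_functions"
  shows "2 * seifert_form L (edge_jump u) (edge_jump u)
    = (\<Sum>d\<in>left_corners. 2 * (u $ d * drop_across u d) +
        (if is_black d then - (drop_across u d)\<^sup>2 else (drop_across u d)\<^sup>2))"
proof -
  have left: "{d. at_crossing d \<and> is_out d \<and> \<not> is_out (rot L d)} = left_corners"
    by (simp add: left_corners_def)
  have next_corner: "u $ flip (rot L d) = u $ d" for d using u by (simp add: region_functions_def)
  have prev_corner: "u $ flip d = u $ rot L (rot L (rot L d))" for d
    using next_corner[of "rot L (rot L (rot L d))"] by simp
  have "2 * seifert_form L (edge_jump u) (edge_jump u)
    = (\<Sum>d\<in>left_corners. 2 * (u $ d * drop_across u d) +
        (if is_black d then - (drop_across u d)\<^sup>2 else (drop_across u d)\<^sup>2) -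
        ((u $ rot L (rot L (rot L d)))\<^sup>2 - (u $ rot L d)\<^sup>2))"
    unfolding seifert_form_def left sum_distrib_left
  proof (rule sum.cong[OF refl])
    fix d assume d: "d \<in> left_corners"
    have 1: "edge_jump u $ edge d = u $ d - u $ rot L (rot L (rot L d))"
      using d by (simp add: edge_jump_edge left_corners_def prev_corner)
    have 2: "edge_jump u $ edge (rot L d) = u $ d - u $ rot L d"
      using d by (simp add: edge_jump_edge left_corners_def next_corner)
    have 3: "over L d \<longleftrightarrow> \<not> is_black d" using d over_iff_white by (simp add: left_corners_def)
    show "2 * ((if over L d then edge_jump u $ edge (rot L d) else edge_jump u $ edge d) *
         (edge_jump u $ edge (rot L d) - edge_jump u $ edge d)) =
       2 * (u $ d * drop_across u d) +
        (if is_black d then - (drop_across u d)\<^sup>2 else (drop_across u d)\<^sup>2) -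
        ((u $ rot L (rot L (rot L d)))\<^sup>2 - (u $ rot L d)\<^sup>2)"
      unfolding 1 2 3 drop_across_def by (simp add: power2_eq_square algebra_simps)
  qed
  then show ?thesis using sum_squares_left_corners[OF u] by (simp add: sum_subtractf)
qed

text \<open>
  The smoothing that respects the orientations is the 0-resolution at positive crossings and the
  1-resolution at negative ones, so the circles of this resolution are the Seifert circles.
\<close>

definition seifert_resolution :: "'e edge_end set set" where
  "seifert_resolution = {c \<in> crossings L. \<not> positive_crossing L c}"

text \<open>
  The smoothing along the orientations joins the top and the bottom corner of a crossing.
\<close>

lemma joined_corner_seifert:
  "joined_corner L seifert_resolution d \<longleftrightarrow> at_crossing d \<and> (is_out d \<longleftrightarrow> is_out (rot L d))"
proof (cases "at_crossing d")
  case True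
  have "positive_crossing L (vertex L d) \<longleftrightarrow> (is_black d \<longleftrightarrow> (is_out d \<longleftrightarrow> \<not> is_out (rot L d)))"
    unfolding positive_crossing_def vertex_eq[of d]
    using True is_out_opposite[of d] is_out_opposite[of "rot L d"]
    by (auto simp: over_iff_white)
  then show ?thesis using True by (auto simp: joined_corner_iff seifert_resolution_def)
qed (simp add: joined_corner_iff)

abbreviation seifert_functions :: "bool \<Rightarrow> (real ^ 'e edge_end) set" where
  "seifert_functions color \<equiv> side_functions seifert_resolution color"

lemma seifert_function_opposite:
  assumes "k \<in> seifert_functions color" "is_out d \<longleftrightarrow> is_out (rot L d)"
  shows "k $ rot L (rot L d) = k $ d"
proof (cases "at_crossing d")
  case True
  then show ?thesis using assms by (auto simp: side_functions_iff joined_corner_seifert)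
qed (simp add: rot_rot_no_crossing)

lemma drop_across_seifert_function:
  assumes "k \<in> seifert_functions color" "d \<in> left_corners"
  shows "drop_across k d = 0"
proof -
  have "is_out (rot L (rot L d)) \<longleftrightarrow> is_out (rot L d)"
    using assms(2) is_out_opposite by (auto simp: left_corners_def)
  then show ?thesis
    using seifert_function_opposite[OF assms(1), of "rot L d"] by (simp add: drop_across_def)
qed

lemma side_function_other_color: "u \<in> side_functions S color \<Longrightarrow> is_black d \<noteq> color \<Longrightarrow> u $ d = 0"
  by (simp add: side_functions_iff)

lemma side_function_in_region_functions: "u \<in> side_functions S color \<Longrightarrow> u \<in> region_functions"
  by (simp add: side_functions_iff region_functions_def)

text \<open>
  Fix a region and consider the values of \<open>k\<close> across its boundary edges. They change only at its top and
  bottom corners, because at every other corner of the region the smoothing joins the two regions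
  next to it. So the value left of a top corner reappears left of the bottom corner at the end of
  the same run of edges, and the contributions of the region cancel.
\<close>

lemma sum_seifert_function_drop_across:
  assumes k: "k \<in> seifert_functions color" and v: "v \<in> region_functions"
  shows "(\<Sum>d\<in>left_corners. k $ d * drop_across v d) = 0"
proof -
  \<comment> \<open>The incoming boundary edges of a region are weighted by the value of \<open>k\<close> across them; along
  the boundary the sum of the increments of \<open>h\<close> telescopes.\<close>
  define h where "h d = (if is_out d then 0 else v $ d * k $ flip d)" for d
  have prev_corner: "k $ flip d = k $ rot L (rot L (rot L d))" for d
    using k unfolding side_functions_iff by (metis rot4)
  have "(\<Sum>d\<in>left_corners. k $ d * drop_across v d)
    = (\<Sum>d\<in>left_corners. v $ rot L (rot L (rot L d)) * k $ rot L (rot L (rot L (rot L d)))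
        - v $ rot L d * k $ rot L (rot L (rot L (rot L d))))"
    by (simp add: drop_across_def algebra_simps)
  also have "\<dots> = (\<Sum>d\<in>UNIV. h (flip (rot L d)) - h d)"
    unfolding sum_left_corners[of "\<lambda>d. v $ d * k $ rot L d" "\<lambda>d. v $ d * k $ rot L (rot L (rot L d))"]
  proof (rule sum.cong[OF refl])
    fix d
    have "v $ flip (rot L d) = v $ d" using v by (simp add: region_functions_def)
    moreover have "k $ rot L (rot L (rot L d)) = k $ rot L d" if "\<not> is_out d" "is_out (rot L d)"
    proof (cases "at_crossing d")
      case True
      then show ?thesis
        using seifert_function_opposite[OF k, of "rot L d"] is_out_opposite[of d] that by simp
    qed (simp add: rot_rot_no_crossing)
    ultimately show "(if is_out d \<and> is_out (rot L d) then v $ d * k $ rot L d else 0)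
        - (if \<not> is_out d \<and> \<not> is_out (rot L d) then v $ d * k $ rot L (rot L (rot L d)) else 0)
      = h (flip (rot L d)) - h d"
      by (auto simp: h_def prev_corner)
  qed
  also have "\<dots> = 0" unfolding sum_subtractf sum_flip_rot by simp
  finally show ?thesis .
qed

text \<open>
  Functions that are constant on the components of the complement of the Seifert circles are mapped
  to combinations of these circles, which lie in the radical of the symmetrized form.
\<close>

lemma seifert_functions_radical:
  assumes k: "k \<in> seifert_functions color" and v: "v \<in> region_functions"
  shows "seifert_form L (edge_jump (k + v)) (edge_jump (k + v)) = seifert_form L (edge_jump v) (edge_jump v)"
proof -
  have "k + v \<in> region_functions"
    using side_function_in_region_functions[OF k] v subspace_add[OF subspace_region_functions] by blast
  moreover have "drop_across (k + v) d = drop_across v d" if "d \<in> left_corners" for d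
    using drop_across_seifert_function[OF k that] by (simp add: drop_across_def)
  ultimately have "2 * seifert_form L (edge_jump (k + v)) (edge_jump (k + v))
    = (\<Sum>d\<in>left_corners. 2 * (k $ d * drop_across v d) + (2 * (v $ d * drop_across v d) +
        (if is_black d then - (drop_across v d)\<^sup>2 else (drop_across v d)\<^sup>2)))"
    by (subst seifert_form_edge_jump) (auto intro!: sum.cong simp: algebra_simps)
  also have "\<dots> = 2 * (\<Sum>d\<in>left_corners. k $ d * drop_across v d)
      + 2 * seifert_form L (edge_jump v) (edge_jump v)"
    unfolding seifert_form_edge_jump[OF v] by (simp add: sum.distrib sum_distrib_left)
  finally have "2 * seifert_form L (edge_jump (k + v)) (edge_jump (k + v))
    = 2 * (\<Sum>d\<in>left_corners. k $ d * drop_across v d) + 2 * seifert_form L (edge_jump v) (edge_jump v)" .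
  then show ?thesis using sum_seifert_function_drop_across[OF k v] by simp
qed

text \<open>
  For this choice of the resolution no corners of the given color are joined, so these are the
  functions on the regions of that color.
\<close>

abbreviation color_functions :: "bool \<Rightarrow> (real ^ 'e edge_end) set" where
  "color_functions color \<equiv> side_functions (if color then {} else crossings L) color"

lemma color_functions_iff:
  "u \<in> color_functions color \<longleftrightarrow> (\<forall>d. is_black d \<noteq> color \<longrightarrow> u $ d = 0) \<and> u \<in> region_functions"
  unfolding side_functions_iff region_functions_def by (auto simp: joined_corner_iff)

lemma dim_color_functions:
  "dim (color_functions color) = card {r \<in> regions L. (r \<in> black) = color}"
  by (rule dim_side_functions_regions) (auto simp: joined_corner_iff split: if_splits)

text \<open>
  A crossing at which the left corner has the given color contributes \<open>0\<close>, since then the top and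
  bottom corner have the other color; at the remaining crossings the mixed term vanishes.
\<close>

lemma seifert_form_color_function:
  assumes u: "u \<in> color_functions color"
  shows "2 * seifert_form L (edge_jump u) (edge_jump u)
    = (if color then 1 else -1) * (\<Sum>d\<in>left_corners. (drop_across u d)\<^sup>2)"
  unfolding seifert_form_edge_jump[OF side_function_in_region_functions[OF u]] sum_distrib_left
proof (rule sum.cong[OF refl])
  fix d
  have u0: "u $ x = 0" if "is_black x \<noteq> color" for x using u that by (simp add: side_functions_iff)
  show "2 * (u $ d * drop_across u d) + (if is_black d then - (drop_across u d)\<^sup>2 else (drop_across u d)\<^sup>2) =
    (if color then 1 else - 1) * (drop_across u d)\<^sup>2"
  proof (cases "is_black d = color")
    case True
    then have "drop_across u d = 0" using u0 by (simp add: drop_across_def)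
    then show ?thesis by simp
  next
    case False
    then show ?thesis using u0 by auto
  qed
qed

text \<open>
  A corner joined by the orientation-respecting smoothing is the top or the bottom of its crossing,
  and the drop at that crossing is the difference of the values that have to agree.
\<close>

lemma color_function_drop_free:
  assumes u: "u \<in> color_functions color" and drop: "\<And>d. d \<in> left_corners \<Longrightarrow> drop_across u d = 0"
  shows "u \<in> seifert_functions color"
  unfolding side_functions_iff
proof (intro conjI allI impI)
  fix d assume "joined_corner L seifert_resolution d"
  then have d: "at_crossing d" "is_out d \<longleftrightarrow> is_out (rot L d)" by (auto simp: joined_corner_seifert)
  show "u $ rot L (rot L d) = u $ d"
  proof (cases "is_out d")
    case True
    then have "rot L d \<in> left_corners" using d is_out_opposite by (simp add: left_corners_def)
    then show ?thesis using drop by (fastforce simp: drop_across_def)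
  next
    case False
    then have "rot L (rot L (rot L d)) \<in> left_corners"
      using d is_out_opposite[of "rot L d"] by (simp add: left_corners_def)
    then show ?thesis using drop by (fastforce simp: drop_across_def)
  qed
qed (use u in \<open>auto simp: side_functions_iff\<close>)

text \<open>
  The form, with the sign that belongs to the color, is nonnegative on functions of this color and
  vanishes there only on the functions that are constant across the Seifert smoothing. An orthogonal
  complement of the latter is therefore positive definite. Adding the latter to the functions of the
  other color, where the form is nonpositive, gives a nonpositive subspace of complementary dimension.
\<close>

lemma positive_index_seifert:
  "int (positive_index (\<lambda>x. (if color then 1 else -1) * (2 * seifert_form L x x)) (cycle_space L))
    = int (dim (color_functions color)) - int (dim (seifert_functions color))"
proof -
  define q where "q x = (if color then 1 else -1) * (2 * seifert_form L x x)" for x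
  let ?U = "color_functions color" and ?U' = "color_functions (\<not> color)" and ?K = "seifert_functions color"
  define P where "P = {y \<in> ?U. \<forall>x\<in>?K. orthogonal x y}"
  define N where "N = {k + w | k w. k \<in> ?K \<and> w \<in> ?U'}"
  have "?K \<subseteq> ?U"
  proof
    fix u assume u: "u \<in> ?K"
    then have "u $ d = 0" if "is_black d \<noteq> color" for d using that by (simp add: side_functions_iff)
    then show "u \<in> ?U" using side_function_in_region_functions[OF u] color_functions_iff by blast
  qed
  have q_U: "q (edge_jump u) = (\<Sum>d\<in>left_corners. (drop_across u d)\<^sup>2)" if "u \<in> ?U" for u
    using seifert_form_color_function[OF that] by (auto simp: q_def)
  have q_U': "q (edge_jump u) = - (\<Sum>d\<in>left_corners. (drop_across u d)\<^sup>2)" if "u \<in> ?U'" for u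
    using seifert_form_color_function[OF that] by (auto simp: q_def)
  have in_K: "u \<in> ?K" if "u \<in> ?U" "q (edge_jump u) \<le> 0" for u
  proof (rule color_function_drop_free[OF that(1)])
    fix d assume d: "d \<in> left_corners"
    have "(\<Sum>d\<in>left_corners. (drop_across u d)\<^sup>2) = 0"
      using that(2) q_U[OF that(1)] by (simp add: sum_nonneg order.antisym)
    then have "(drop_across u d)\<^sup>2 = 0"
      using d by (subst (asm) sum_nonneg_eq_0_iff) auto
    then show "drop_across u d = 0" by simp
  qed
  have subU: "subspace ?U" and subK: "subspace ?K" and subU': "subspace ?U'"
    by (rule subspace_class_functions)+
  have "P = ?U \<inter> {y. \<forall>x\<in>?K. orthogonal x y}" by (auto simp: P_def)
  then have subP: "subspace P"
    using subspace_inter[OF subU subspace_orthogonal_to_vectors] by simp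
  have P0: "u = 0" if "u \<in> P" "q (edge_jump u) \<le> 0" for u
  proof -
    have "u \<in> ?K" using in_K that by (simp add: P_def)
    then have "orthogonal u u" using that(1) by (auto simp: P_def)
    then show ?thesis by (simp add: orthogonal_self)
  qed
  have q0: "q 0 = 0" by (simp add: q_def seifert_form_def)
  have "inj_on edge_jump P"
  proof (rule inj_onI)
    fix x y assume xy: "x \<in> P" "y \<in> P" "edge_jump x = edge_jump y"
    then have "edge_jump (x - y) = 0" using linear_diff[OF linear_edge_jump] by simp
    then show "x = y" using P0[of "x - y"] xy subspace_diff[OF subP] q0 by simp
  qed
  then have dimP: "dim (edge_jump ` P) = dim P"
    using dim_image_eq[OF linear_edge_jump] span_eq_iff[of P] subP by metis
  have dimPK: "dim P + dim ?K = dim ?U"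
    unfolding P_def by (rule dim_subspace_orthogonal_to_vectors[OF subK subU \<open>?K \<subseteq> ?U\<close>])
  have N_region: "N \<subseteq> region_functions"
  proof
    fix u assume "u \<in> N"
    then obtain k w where "k \<in> ?K" "w \<in> ?U'" "u = k + w" by (auto simp only: N_def mem_Collect_eq)
    then show "u \<in> region_functions"
      using side_function_in_region_functions subspace_add[OF subspace_region_functions] by metis
  qed
  have subN: "subspace N" unfolding N_def by (rule subspace_sums[OF subK subU'])
  have "?K \<inter> ?U' \<subseteq> {0}"
  proof
    fix u assume "u \<in> ?K \<inter> ?U'"
    then have u: "u \<in> ?K" "u \<in> ?U'" by blast+
    have "u $ d = 0" for d
      using side_function_other_color[OF u(1), of d] side_function_other_color[OF u(2), of d] by blast
    then show "u \<in> {0}" by (simp add: vec_eq_iff)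
  qed
  then have "dim (?K \<inter> ?U') = 0" by (simp only: dim_eq_0)
  then have dimN: "dim N = dim ?K + dim ?U'"
    using dim_sums_Int[OF subK subU', folded N_def] by linarith
  have "dim N \<le> dim (edge_jump ` N) + 1"
  proof (rule dim_edge_jump_image[OF subN])
    fix u d assume "u \<in> N" "\<And>d. u $ flip d = u $ d"
    then show "u $ rot L d = u $ d"
      using N_region unfolding region_functions_def by (metis (mono_tags, lifting) mem_Collect_eq subsetD)
  qed
  moreover have "dim (cycle_space L) + 1 \<le> dim ?U + dim ?U'"
    using dim_cycle_space card_black_white unfolding dim_color_functions by (cases color) auto
  ultimately have dimZ: "dim (cycle_space L) \<le> dim (edge_jump ` P) + dim (edge_jump ` N)"
    using dimP dimPK dimN by linarith
  have "positive_index q (cycle_space L) = dim (edge_jump ` P)"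
  proof (rule positive_index_eqI[OF subspace_cycle_space _ _ _ _ _ _ dimZ])
    show "subspace (edge_jump ` P)" "subspace (edge_jump ` N)"
      using linear_subspace_image[OF linear_edge_jump] subP subN by blast+
    show "edge_jump ` P \<subseteq> cycle_space L"
      using edge_jump_in_cycle_space[OF side_function_in_region_functions] unfolding P_def by blast
    show "edge_jump ` N \<subseteq> cycle_space L" using edge_jump_in_cycle_space N_region by blast
    show "q x > 0" if "x \<in> edge_jump ` P" "x \<noteq> 0" for x
      using that P0 linear_0[OF linear_edge_jump] by (metis image_iff not_le)
    show "q x \<le> 0" if x: "x \<in> edge_jump ` N" for x
    proof -
      from x obtain k w where kw: "k \<in> ?K" "w \<in> ?U'" "x = edge_jump (k + w)"
        by (auto simp only: N_def mem_Collect_eq)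
      have "q x = q (edge_jump w)"
        using seifert_functions_radical[OF kw(1) side_function_in_region_functions[OF kw(2)]] kw(3)
        by (simp add: q_def)
      then show ?thesis using q_U'[OF kw(2)] by (simp add: sum_nonneg)
    qed
  qed
  then show ?thesis using dimP dimPK unfolding q_def by linarith
qed

text \<open>
  The two indices are the numbers of black and white regions, each reduced by the number of Seifert
  components of that color. The difference of the latter numbers is the balance of the Seifert
  resolution.
\<close>

lemma link_signature_eq:
  "link_signature L = int (card {r \<in> regions L. r \<in> black}) - 1 - int (n_plus L)"
proof -
  let ?N = "card {r \<in> regions L. r \<in> black}" and ?W = "card {r \<in> regions L. r \<notin> black}"
  have "seifert_resolution \<union> {c \<in> crossings L. positive_crossing L c} = crossings L"
    by (auto simp: seifert_resolution_def)
  then have "card seifert_resolution + n_plus L = card (crossings L)"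
    unfolding n_plus_def by (subst card_Un_disjoint[symmetric]) (auto simp: seifert_resolution_def)
  moreover have "side_balance seifert_resolution = int ?N - 1 - int (card seifert_resolution)"
    by (rule side_balance_eq) (auto simp: seifert_resolution_def)
  moreover have "link_signature L
    = (int ?N - int (dim (seifert_functions True))) - (int ?W - int (dim (seifert_functions False)))"
    using positive_index_seifert[of True] positive_index_seifert[of False]
      dim_color_functions[of True] dim_color_functions[of False]
    by (simp add: link_signature_def)
  ultimately show ?thesis using card_black_white by (simp add: side_balance_def)
qed

section \<open>Resolutions without contractible circles\<close>

text \<open>
  The two sides are the same circle walked in opposite directions.
\<close>

lemma edge_image_orbit_reversed:
  "edge ` orbit (\<lambda>d. arc_partner L S (flip d)) d = edge ` orbit (trace_side S) (flip d)"
proof -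
  let ?g = "\<lambda>d. arc_partner L S (flip d)"
  have 1: "flip y \<in> orbit (trace_side S) (flip d)" if "y \<in> orbit ?g d" for y
    using that
  proof induction
    case base
    show ?case unfolding trace_side_def[symmetric] by (rule orbit.base)
  next
    case (step y)
    show ?case unfolding trace_side_def[symmetric] by (rule orbit.step[OF step.IH])
  qed
  have 2: "flip y \<in> orbit ?g d" if "y \<in> orbit (trace_side S) (flip d)" for y
    using that
  proof induction
    case base
    show ?case using orbit.base[of ?g d] by (simp add: trace_side_def)
  next
    case (step y)
    show ?case using orbit.step[OF step.IH] by (simp add: trace_side_def)
  qed
  show ?thesis
  proof (intro subset_antisym image_subsetI)
    show "edge y \<in> edge ` orbit (trace_side S) (flip d)" if "y \<in> orbit ?g d" for y
      using imageI[OF 1[OF that], of edge] by simp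
    show "edge y \<in> edge ` orbit ?g d" if "y \<in> orbit (trace_side S) (flip d)" for y
      using imageI[OF 2[OF that], of edge] by simp
  qed
qed

lemma edge_image_orbit_flip:
  "edge ` orbit (trace_side S) (flip d) = edge ` orbit (trace_side S) d"
proof -
  have "inv (trace_side S) x = arc_partner L S (flip x)" for x
    by (rule inv_f_eq)
      (simp_all add: bij_is_inj[OF permutation_bijective[OF permutation_trace_side]]
        trace_side_def arc_partner_involution)
  then have "orbit (\<lambda>d. arc_partner L S (flip d)) d = orbit (trace_side S) d"
    using orbit_inv_eq[OF permutation_trace_side[of S], of d] by presburger
  then show ?thesis using edge_image_orbit_reversed[of S d] by simp
qed

lemma circles_eq: "circles L S = (\<lambda>d. edge ` orbit (trace_side S) d) ` {d. is_black d}"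
proof
  let ?circle = "\<lambda>d. edge ` orbit (trace_side S) d"
  have range: "circles L S = range ?circle"
    unfolding circles_def edge_image_orbit_reversed edge_image_orbit_flip ..
  show "circles L S \<subseteq> ?circle ` {d. is_black d}"
    unfolding range
  proof (rule image_subsetI)
    fix d
    show "?circle d \<in> ?circle ` {d. is_black d}"
    proof (cases "is_black d")
      case True
      then show ?thesis by (intro imageI) simp
    next
      case False
      then have "?circle (flip d) \<in> ?circle ` {d. is_black d}" by (intro imageI) simp
      then show ?thesis by (simp only: edge_image_orbit_flip)
    qed
  qed
  show "?circle ` {d. is_black d} \<subseteq> circles L S"
    unfolding range by (rule image_mono) simp
qed

lemma circle_through:
  assumes "C \<in> circles L S" "is_black d" "edge d \<in> C"
  shows "C = edge ` orbit (trace_side S) d"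
proof -
  obtain x where x: "is_black x" "C = edge ` orbit (trace_side S) x"
    using assms(1) by (auto simp: circles_eq)
  then obtain y where y: "y \<in> orbit (trace_side S) x" "edge d = edge y" using assms(3) by blast
  have "is_black y" using color_orbit_trace_side[OF y(1)] x(1) by simp
  then have "d = y" using y(2) assms(2) by (auto simp: edge_eq_iff)
  then show ?thesis using permutation_orbit_eq[OF permutation_trace_side y(1)] x(2) by simp
qed

lemma side_steps_color: "(d, d') \<in> (side_steps L S)\<^sup>* \<Longrightarrow> is_black d' \<longleftrightarrow> is_black d"
  by (induction rule: rtrancl_induct) (auto simp: side_steps_def)

lemma side_steps_same_side:
  assumes "(d, d') \<in> (side_steps L S)\<^sup>*"
  shows "(region L d, region L d') \<in> same_side L S C"
  using assms
proof induction
  case (step y z)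
  have joined: "(region L x, region L (rot L (rot L x))) \<in> same_side L S C" if "joined_corner L S x" for x
    using that unfolding same_side_def by blast
  have "(region L y, region L z) \<in> same_side L S C"
  proof -
    consider "region L z = region L y" | "joined_corner L S y" "z = rot L (rot L y)"
      | "joined_corner L S z" "y = rot L (rot L z)"
      using step(2) unfolding side_steps_def by auto
    then show ?thesis
    proof cases
      case 1
      then show ?thesis by (simp add: same_side_def)
    next
      case 2
      then show ?thesis using joined by blast
    next
      case 3
      then have "joined_corner L S y" by (simp add: joined_corner_iff)
      then show ?thesis using joined[of y] 3 by simp
    qed
  qed
  then show ?case using step.IH unfolding same_side_def by (rule rtrancl_trans[rotated])
qed (simp add: same_side_def)

text \<open>
  The components of the complement and the circles form the vertices and edges of a connected graph, each
  circle joining its black to its white side. A circle is noncontractible if it separates the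
  component of the origin from the unbounded one, so the graph is a path and its colors alternate.
\<close>

lemma side_balance_noncontractible:
  assumes noncontractible: "\<And>C. C \<in> circles L S \<Longrightarrow> \<not> contractible_circle L S C"
  shows "side_balance S =
    (if odd (card (circles L S)) then 0 else if unbounded_region L \<in> black then 1 else -1)"
proof -
  define cls where "cls d = (side_steps L S)\<^sup>* `` {d}" for d
  have cls_eq: "cls d = cls d'" if "(d, d') \<in> (side_steps L S)\<^sup>*" for d d'
    using that symD[OF sym_rtrancl[OF sym_side_steps]] unfolding cls_def by (blast intro: rtrancl_trans)
  have cls_eqD: "(d, d') \<in> (side_steps L S)\<^sup>*" if "cls d = cls d'" for d d'
    using that by (auto simp: cls_def)
  define col where "col v \<longleftrightarrow> (\<exists>d\<in>v. is_black d)" for v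
  have col_cls: "col (cls d) \<longleftrightarrow> is_black d" for d
    using side_steps_color by (auto simp: col_def cls_def)
  obtain o' u where o': "origin_region L = region L o'" and u: "unbounded_region L = region L u"
    using diagram by (auto simp: connected_link_diagram_def regions_def)
  define rep where "rep C = (SOME d. is_black d \<and> edge d \<in> C)" for C
  define a where "a C = cls (rep C)" for C
  define b where "b C = cls (flip (rep C))" for C
  have rep: "is_black (rep C) \<and> edge (rep C) \<in> C" if "C \<in> circles L S" for C
  proof -
    have "\<exists>d. is_black d \<and> edge d \<in> C"
      using that permutation_self_in_orbit[OF permutation_trace_side] by (auto simp: circles_eq)
    then show ?thesis unfolding rep_def by (rule someI_ex)
  qed
  have sides: "a C = cls d \<and> b C = cls (flip d)" if C: "C \<in> circles L S" "is_black d" "edge d \<in> C" for C d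
  proof -
    have "edge (rep C) \<in> edge ` orbit (trace_side S) d" using circle_through[OF C] rep[OF C(1)] by simp
    then obtain y where y: "y \<in> orbit (trace_side S) d" "edge (rep C) = edge y" by blast
    have "is_black y" using color_orbit_trace_side[OF y(1)] C(2) by simp
    then have "rep C = y" using y(2) rep[OF C(1)] by (auto simp: edge_eq_iff)
    then show ?thesis using orbit_trace_side_steps[OF y(1)] by (simp add: a_def b_def cls_eq)
  qed
  have flip_joined: "(cls d, cls (flip d)) \<in> joined_by a b (circles L S)" for d
  proof -
    obtain x where x: "is_black x" "x = d \<or> x = flip d" by (metis color_flip)
    let ?C = "edge ` orbit (trace_side S) x"
    have "?C \<in> circles L S" using x(1) by (auto simp: circles_eq)
    moreover have "edge x \<in> ?C" using permutation_self_in_orbit[OF permutation_trace_side] by blast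
    ultimately have "a ?C = cls x \<and> b ?C = cls (flip x)" using sides x(1) by blast
    then show ?thesis using \<open>?C \<in> circles L S\<close> x(2) unfolding joined_by_def by force
  qed
  have cls_rot: "cls (flip (rot L d)) = cls d" for d
    by (rule cls_eq[symmetric]) (auto simp: side_steps_def)
  have connected: "(cls o', cls d) \<in> (joined_by a b (circles L S))\<^sup>*" for d
  proof (rule edge_end_induct[of "\<lambda>d. (cls o', cls d) \<in> (joined_by a b (circles L S))\<^sup>*" o'])
    fix d assume IH: "(cls o', cls d) \<in> (joined_by a b (circles L S))\<^sup>*"
    show "(cls o', cls (flip d)) \<in> (joined_by a b (circles L S))\<^sup>*"
      using IH flip_joined[of d] by (rule rtrancl_into_rtrancl)
    show "(cls o', cls (rot L d)) \<in> (joined_by a b (circles L S))\<^sup>*"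
      using IH flip_joined[of "flip (rot L d)"] cls_rot[of d] by (auto intro: rtrancl_into_rtrancl)
  qed simp
  have side: "\<forall>d. v = cls d \<longrightarrow> (region L o', region L d) \<in> same_side L S C"
    if C: "C \<in> circles L S" and v: "(cls o', v) \<in> (joined_by a b (circles L S - {C}))\<^sup>*" for C v
    using v
  proof induction
    case base
    then show ?case using cls_eqD side_steps_same_side by blast
  next
    case (step y z)
    obtain D where D: "D \<in> circles L S" "D \<noteq> C" "y = a D \<and> z = b D \<or> y = b D \<and> z = a D"
      using step(2) by (auto simp: joined_by_def)
    define x where "x = (if y = a D \<and> z = b D then rep D else flip (rep D))"
    have yz: "y = cls x" "z = cls (flip x)" using D(3) by (auto simp: x_def a_def b_def)
    have "edge (rep D) \<notin> C"
      using circle_through[OF C, of "rep D"] circle_through[OF D(1), of "rep D"] rep[OF D(1)] D(2) by metis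
    then have "edge x \<notin> C" by (simp add: x_def)
    then have "(region L x, region L (flip x)) \<in> same_side L S C" unfolding same_side_def by blast
    moreover have "(region L o', region L x) \<in> same_side L S C" using step.IH yz(1) by blast
    ultimately have "(region L o', region L (flip x)) \<in> same_side L S C"
      unfolding same_side_def by (rule rtrancl_trans[rotated])
    moreover have "(region L (flip x), region L d) \<in> same_side L S C" if "z = cls d" for d
      using that yz(2) cls_eqD side_steps_same_side by blast
    ultimately show ?case unfolding same_side_def by (blast intro: rtrancl_trans)
  qed
  let ?V = "range cls"
  have "int (card {v \<in> ?V. col v}) - int (card {v \<in> ?V. \<not> col v})
    = (if odd (card (circles L S)) then 0 else if col (cls u) then 1 else -1)"
  proof (rule bicolored_path_color_balance[of ?V "circles L S" "cls o'" "cls u" a b])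
    show "finite (circles L S)" by (simp add: circles_def)
    show "a C \<in> ?V \<and> b C \<in> ?V \<and> col (a C) \<and> \<not> col (b C)" if "C \<in> circles L S" for C
      using rep[OF that] by (simp add: a_def b_def col_cls)
    show "(cls o', cls u) \<notin> (joined_by a b (circles L S - {C}))\<^sup>*" if "C \<in> circles L S" for C
      using side[OF that] noncontractible[OF that] unfolding contractible_circle_def o' u by blast
  qed (use connected in auto)
  moreover have "{v \<in> ?V. col v} = cls ` {d. is_black d = True}" "{v \<in> ?V. \<not> col v} = cls ` {d. is_black d = False}"
    using col_cls by auto
  moreover have "dim (side_functions S c) = card (cls ` {d. is_black d = c})" for c
    unfolding dim_side_functions cls_def ..
  ultimately show ?thesis
    unfolding side_balance_def u by (simp only: col_cls)
qed

end

section \<open>Supporting gradings\<close>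

lemma even_sign_sum: "even (sign_sum L r) \<longleftrightarrow> even (card (circles L (fst r)))"
proof -
  have "even (\<Sum>C\<in>A. sign P C) \<longleftrightarrow> even (card A)" if "finite A" for A :: "'b set set" and P
    using that by induction (auto simp: sign_def)
  then show ?thesis by (cases "finite (circles L (fst r))") (auto simp: sign_sum_def)
qed

text \<open>
  A nonzero homology class has a nonzero representative, and some state occurs in it.
\<close>

lemma HT_nonzero_state:
  assumes "HT_nonzero L g d"
  obtains r where "r \<in> CT_basis L g" "delta L r = d"
proof (rule ccontr)
  assume "\<not> thesis"
  then have none: "\<not> (r \<in> CT_basis L g \<and> delta L r = d)" for r using that by blast
  then have "x = (\<lambda>_. 0)" if "x \<in> CT L g d" for x
    using that unfolding CT_def by (intro ext) blast
  moreover have "(\<lambda>_. 0) \<in> CT L g d" by (simp add: CT_def)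
  ultimately have CT: "CT L g d = {\<lambda>_. 0}" by blast
  have "boundary_CT L g (\<lambda>_. 0) = (\<lambda>_. 0)" by (rule ext) (simp add: boundary_CT_def)
  then have cycles: "cycles_CT L g d = {\<lambda>_. 0}" unfolding cycles_CT_def CT by blast
  have "HT L g d = {boundaries_CT L g d}" unfolding HT_def cycles by simp
  then show False using assms by (simp add: HT_nonzero_def)
qed

theorem corollary1p7:
  fixes L :: "'e::{finite,linorder} diagram"
    and black :: "'e edge_end set set"
    and k d :: int
  assumes "connected_link_diagram L"
    and "alternating L"
    and "checkerboard L black"
    and "one_resolutions_merge L black"
    and "HT_nonzero L (unit_circle_glyph k) d"
  shows "(odd k \<and> d + k = link_signature L) \<or>
    (even k \<and> unbounded_region L \<in> black \<and> d + k = link_signature L - 1) \<or>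
    (even k \<and> unbounded_region L \<notin> black \<and> d + k = link_signature L + 1)"
proof -
  interpret colored_diagram L black by unfold_locales fact+
  obtain r where r: "r \<in> CT_basis L (unit_circle_glyph k)" "delta L r = d"
    using assms(5) by (rule HT_nonzero_state)
  define S where "S = fst r"
  have S: "S \<subseteq> crossings L" "\<And>C. C \<in> circles L S \<Longrightarrow> \<not> contractible_circle L S C"
    using r(1) by (auto simp: CT_basis_def states_def S_def)
  have k: "sign_sum L r = k"
    using r(1) by (auto simp: CT_basis_def gl_def unit_circle_glyph_def glyph_def split: if_splits)
  have parity: "odd (card (circles L S)) \<longleftrightarrow> odd k"
    using even_sign_sum[of L r] k by (simp add: S_def)
  have "d + k = link_signature L - side_balance S"
    using r(2) k side_balance_eq[OF S(1)] link_signature_eq by (simp add: delta_def S_def)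
  then show ?thesis using side_balance_noncontractible[OF S(2)] parity by (auto split: if_splits)
qed

end
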